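(* Consider the algorithm sGS-imsPADMM (described in the context) for the problem $\min\{p_1(x_1)+f(x)+q_1(y_1)+g(y)\mid \mathcal A^*x+\mathcal B^*y=c\}$, and suppose that $\widetilde{\mathcal M}_d\succ0$ and $\widetilde{\mathcal N}_d\succ0$. Then the sequences $\{w^k=(x^k,y^k,z^k)\}$, $\{\delta^k\}$, $\{\widetilde\delta^k\}$, $\{\gamma^k\}$, $\{\widetilde\gamma^k\}$ generated by the sGS-imsPADMM are well-defined, and $$\widehat{\mathcal M}=\widetilde{\mathcal M}+\mathrm{sGS}(\widetilde{\mathcal M})\succ0,\qquad \widehat{\mathcal N}=\widetilde{\mathcal N}+\mathrm{sGS}(\widetilde{\mathcal N})\succ0 .$$ Moreover, for every $k\ge0$ the vectors $$d_x^k:=\delta^k+\widetilde{\mathcal M}_u\widetilde{\mathcal M}_d^{-1}(\delta^k-\widetilde\delta^k),\qquad d_y^k:=\gamma^k+\widetilde{\mathcal N}_u\widetilde{\mathcal N}_d^{-1}(\gamma^k-\widetilde\gamma^k)$$ satisfy $$d_x^k\in\partial_x\Bigl(\widehat{\mathcal L}_\sigma(x,y^k;w^k)+\tfrac12\|x-x^k\|^2_{\widehat{\mathcal S}}\Bigr)\Big|_{x=x^{k+1}},\qquad d_y^k\in\partial_y\Bigl(\widehat{\mathcal L}_\sigma(x^{k+1},y;w^k)+\tfrac12\|y-y^k\|^2_{\widehat{\mathcal T}}\Bigr)\Big|_{y=y^{k+1}},$$ and $$\|\widehat{\mathcal M}^{-1/2}d_x^k\|\le\kappa\,\widetilde\varepsilon_k,\qquad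 \|\widehat{\mathcal N}^{-1/2}d_y^k\|\le\kappa'\,\widetilde\varepsilon_k,$$ where $$\kappa:=2\sqrt{m-1}\,\|\widetilde{\mathcal M}_d^{-1/2}\|+\sqrt m\,\|\widetilde{\mathcal M}_d^{1/2}(\widetilde{\mathcal M}_d+\widetilde{\mathcal M}_u)^{-1}\|,\qquad \kappa':=2\sqrt{n-1}\,\|\widetilde{\mathcal N}_d^{-1/2}\|+\sqrt n\,\|\widetilde{\mathcal N}_d^{1/2}(\widetilde{\mathcal N}_d+\widetilde{\mathcal N}_u)^{-1}\|.$$
   Context: Problem. Let $m,n\ge1$ be integers, let $\mathcal Z,\mathcal X_1,\dots,\mathcal X_m,\mathcal Y_1,\dots,\mathcal Y_n$ be finite dimensional real Euclidean spaces, $\mathcal X=\mathcal X_1\times\cdots\times\mathcal X_m$, $\mathcal Y=\mathcal Y_1\times\cdots\times\mathcal Y_n$. Let $p_1:\mathcal X_1\to(-\infty,\infty]$ and $q_1:\mathcal Y_1\to(-\infty,\infty]$ be closed proper convex functions, $p(x):=p_1(x_1)$, $q(y):=q_1(y_1)$; let $f:\mathcal X\to\mathbb R$, $g:\mathcal Y\to\mathbb R$ be continuously differentiable convex functions with Lipschitz continuous gradients; let $\mathcal A_i:\mathcal Z\to\mathcal X_i$, $\mathcal B_j:\mathcal Z\to\mathcal Y_j$ be linear maps, and let $\mathcal A:\mathcal Z\to\mathcal X$, $\mathcal B:\mathcal Z\to\mathcal Y$ be the linear maps with $\mathcal A^*x=\sum_{i=1}^m\mathcal A_i^*x_i$, $\mathcal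 B^*y=\sum_{j=1}^n\mathcal B_j^*y_j$; let $c\in\mathcal Z$. The problem is $\min\{p(x)+f(x)+q(y)+g(y)\mid\mathcal A^*x+\mathcal B^*y=c\}$. Notation. For self-adjoint positive semidefinite $\mathcal H$, $\|u\|^2_{\mathcal H}:=\langle u,\mathcal Hu\rangle$ and $\mathcal H^{1/2}$ is its positive semidefinite square root; operator norms are induced norms. For a vector with blocks $u=(u_1,\dots,u_s)$, $u_{\le i}=(u_1,\dots,u_i)$ and $u_{\ge i}=(u_i,\dots,u_s)$. For a self-adjoint positive semidefinite $\mathcal H$ on $\mathcal U_1\times\cdots\times\mathcal U_s$ with blocks $\mathcal H_{ij}$, $\mathcal H_u$ is its strictly upper block triangular part, $\mathcal H_d=\mathrm{Diag}(\mathcal H_{11},\dots,\mathcal H_{ss})$ its block diagonal part (so $\mathcal H=\mathcal H_d+\mathcal H_u+\mathcal H_u^*$), and, when $\mathcal H_d\succ0$, $\mathrm{sGS}(\mathcal H):=\mathcal H_u\mathcal H_d^{-1}\mathcal H_u^*$. Majorized augmented Lagrangian. $\widehat\Sigma_f$ on $\mathcal X$ and $\widehat\Sigma_g$ on $\mathcal Y$ are fixed self-adjoint positive semidefinite operators such that for all $x,x',y,y'$: $f(x)\le\widehat f(x;x'):=f(x')+\langle\nabla f(x'),x-x'\rangle+\frac12\|x-x'\|^2_{\widehat\Sigma_f}$ and $g(y)\le\widehat g(y;y'):=g(y')+\langle\nabla g(y'),y-y'\rangle+\frac12\|y-y'\|^2_{\widehat\Sigma_g}$. For $\sigma>0$ and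 $w^k=(x^k,y^k,z^k)$, $$\widehat{\mathcal L}_\sigma(x,y;w^k):=p(x)+\widehat f(x;x^k)+q(y)+\widehat g(y;y^k)+\langle z^k,\mathcal A^*x+\mathcal B^*y-c\rangle+\tfrac\sigma2\|\mathcal A^*x+\mathcal B^*y-c\|^2 .$$ Operators. $\widetilde{\mathcal S}_i$ on $\mathcal X_i$ ($1\le i\le m$) and $\widetilde{\mathcal T}_j$ on $\mathcal Y_j$ ($1\le j\le n$) are self-adjoint positive semidefinite. Set $\widetilde{\mathcal M}:=\widehat\Sigma_f+\sigma\mathcal A\mathcal A^*+\mathrm{Diag}(\widetilde{\mathcal S}_1,\dots,\widetilde{\mathcal S}_m)$, $\widetilde{\mathcal N}:=\widehat\Sigma_g+\sigma\mathcal B\mathcal B^*+\mathrm{Diag}(\widetilde{\mathcal T}_1,\dots,\widetilde{\mathcal T}_n)$, with $\widetilde{\mathcal M}_d,\widetilde{\mathcal M}_u,\widetilde{\mathcal N}_d,\widetilde{\mathcal N}_u$ their block diagonal and strictly upper block triangular parts, and $\widehat{\mathcal S}:=\mathrm{Diag}(\widetilde{\mathcal S}_1,\dots,\widetilde{\mathcal S}_m)+\mathrm{sGS}(\widetilde{\mathcal M})$, $\widehat{\mathcal M}:=\widehat\Sigma_f+\sigma\mathcal A\mathcal A^*+\widehat{\mathcal S}$, $\widehat{\mathcal T}:=\mathrm{Diag}(\widetilde{\mathcal T}_1,\dots,\widetilde{\mathcal T}_n)+\mathrm{sGS}(\widetilde{\mathcal N})$, $\widehat{\mathcal N}:=\widehat\Sigma_g+\sigma\mathcal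 B\mathcal B^*+\widehat{\mathcal T}$. Algorithm sGS-imsPADMM. Let $\tau\in(0,(1+\sqrt5)/2)$, let $\{\widetilde\varepsilon_k\}_{k\ge0}$ be a summable sequence of nonnegative numbers, $(x^0,y^0,z^0)\in\operatorname{dom}p\times\operatorname{dom}q\times\mathcal Z$. For $k=0,1,\dots$: (1a) for $i=m,\dots,2$ compute an approximate minimizer $\widetilde x_i^{k+1}$ over $x_i\in\mathcal X_i$ of $\widehat{\mathcal L}_\sigma(x^k_{\le i-1},x_i,\widetilde x^{k+1}_{\ge i+1},y^k;w^k)+\frac12\|x_i-x_i^k\|^2_{\widetilde{\mathcal S}_i}$, in the sense that there is $\widetilde\delta_i^k\in\partial_{x_i}\widehat{\mathcal L}_\sigma(x^k_{\le i-1},\widetilde x_i^{k+1},\widetilde x^{k+1}_{\ge i+1},y^k;w^k)+\widetilde{\mathcal S}_i(\widetilde x_i^{k+1}-x_i^k)$ with $\|\widetilde\delta_i^k\|\le\widetilde\varepsilon_k$; (1b) for $i=1,\dots,m$ compute $x_i^{k+1}$ and $\delta_i^k\in\partial_{x_i}\widehat{\mathcal L}_\sigma(x^{k+1}_{\le i-1},x_i^{k+1},\widetilde x^{k+1}_{\ge i+1},y^k;w^k)+\widetilde{\mathcal S}_i(x_i^{k+1}-x_i^k)$ with $\|\delta_i^k\|\le\widetilde\varepsilon_k$; (2a) for $j=n,\dots,2$ compute $\widetilde y_j^{k+1}$ and $\widetilde\gamma_j^k\in\partial_{y_j}\widehat{\mathcal L}_\sigma(x^{k+1},y^k_{\le j-1},\widetilde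 y_j^{k+1},\widetilde y^{k+1}_{\ge j+1};w^k)+\widetilde{\mathcal T}_j(\widetilde y_j^{k+1}-y_j^k)$ with $\|\widetilde\gamma_j^k\|\le\widetilde\varepsilon_k$; (2b) for $j=1,\dots,n$ compute $y_j^{k+1}$ and $\gamma_j^k\in\partial_{y_j}\widehat{\mathcal L}_\sigma(x^{k+1},y^{k+1}_{\le j-1},y_j^{k+1},\widetilde y^{k+1}_{\ge j+1};w^k)+\widetilde{\mathcal T}_j(y_j^{k+1}-y_j^k)$ with $\|\gamma_j^k\|\le\widetilde\varepsilon_k$; (3) $z^{k+1}:=z^k+\tau\sigma(\mathcal A^*x^{k+1}+\mathcal B^*y^{k+1}-c)$. Set $\widetilde\delta_1^k:=\delta_1^k$, $\widetilde\gamma_1^k:=\gamma_1^k$, and $\delta^k=(\delta^k_1,\dots,\delta^k_m)$, $\widetilde\delta^k=(\widetilde\delta^k_1,\dots,\widetilde\delta^k_m)$, $\gamma^k=(\gamma_1^k,\dots,\gamma_n^k)$, $\widetilde\gamma^k=(\widetilde\gamma_1^k,\dots,\widetilde\gamma_n^k)$. "Well-defined" means that at every iteration vectors satisfying the requirements of each step exist. *)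

theory Defs
  imports "HOL-Analysis.Analysis"
begin

text \<open>
  A product of Euclidean spaces \<open>X\<^sub>1 \<times> \<dots> \<times> X\<^sub>m\<close>, whose factors may have different dimensions, is
  represented as an orthogonal direct sum: a Euclidean space together with pairwise orthogonal
  subspaces \<open>X 1, \<dots>, X m\<close> spanning it. The tuple \<open>(u\<^sub>1, \<dots>, u\<^sub>m)\<close> is the vector \<open>u\<^sub>1 + \<dots> + u\<^sub>m\<close>, and its
  \<open>i\<close>-th entry is recovered by the orthogonal projection \<open>blk X i\<close>. A map between factors is a
  map on the whole spaces of which only the values on the source factor matter.
\<close>

definition orthogonal_blocks :: "(nat \<Rightarrow> 'a::euclidean_space set) \<Rightarrow> nat \<Rightarrow> bool" where
  "orthogonal_blocks X m \<longleftrightarrow>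
     (\<forall>i\<in>{1..m}. subspace (X i)) \<and>
     (\<forall>i\<in>{1..m}. \<forall>j\<in>{1..m}. i \<noteq> j \<longrightarrow> (\<forall>u\<in>X i. \<forall>v\<in>X j. orthogonal u v)) \<and>
     span (\<Union>i\<in>{1..m}. X i) = UNIV"

definition blk :: "(nat \<Rightarrow> 'a::euclidean_space set) \<Rightarrow> nat \<Rightarrow> 'a \<Rightarrow> 'a" where
  "blk X i u = (THE v. v \<in> X i \<and> (\<forall>w\<in>X i. orthogonal (u - v) w))"

lemma blk_eqI:
  assumes "subspace (X i)" "v \<in> X i" "\<And>w. w \<in> X i \<Longrightarrow> orthogonal (u - v) w"
  shows "blk X i u = v"
  unfolding blk_def
proof (rule the_equality)
  fix v' assume v': "v' \<in> X i \<and> (\<forall>w\<in>X i. orthogonal (u - v') w)"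
  have "v' - v \<in> X i" using assms(1,2) v' by (simp add: subspace_diff)
  hence "orthogonal (u - v) (v' - v)" "orthogonal (u - v') (v' - v)"
    using assms(3) v' by auto
  hence "(v' - v) \<bullet> (v' - v) = 0" by (simp add: orthogonal_def inner_diff_left)
  thus "v' = v" by simp
qed (use assms in auto)

lemma blk_of_sum:
  assumes "orthogonal_blocks X m" "\<And>l. l \<in> {1..m} \<Longrightarrow> u l \<in> X l" "i \<in> {1..m}"
  shows "blk X i (\<Sum>l\<in>{1..m}. u l) = u i"
proof (rule blk_eqI)
  fix w assume w: "w \<in> X i"
  have "(\<Sum>l\<in>{1..m}. u l) - u i = (\<Sum>l\<in>{1..m} - {i}. u l)"
    using assms(3) by (simp add: sum_diff1)
  moreover have "u l \<bullet> w = 0" if "l \<in> {1..m} - {i}" for l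
    using assms w that unfolding orthogonal_blocks_def orthogonal_def by blast
  ultimately show "orthogonal ((\<Sum>l\<in>{1..m}. u l) - u i) w"
    by (simp add: orthogonal_def inner_sum_left)
qed (use assms in \<open>auto simp: orthogonal_blocks_def\<close>)

lemma orthogonal_blocks_decomp:
  assumes "orthogonal_blocks X m"
  shows "\<exists>v. (\<forall>l\<in>{1..m}. v l \<in> X l) \<and> u = (\<Sum>l\<in>{1..m}. v l)"
proof -
  let ?W = "{\<Sum>l\<in>{1..m}. v l | v. \<forall>l\<in>{1..m}. v l \<in> X l}"
  have sub: "\<And>l. l \<in> {1..m} \<Longrightarrow> subspace (X l)"
    using assms by (simp add: orthogonal_blocks_def)
  have "subspace ?W"
    unfolding subspace_def
  proof (intro conjI ballI allI)
    show "0 \<in> ?W"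
      using sub by (auto intro!: exI[of _ "\<lambda>_. 0"] simp: subspace_0)
  next
    fix a b assume "a \<in> ?W" "b \<in> ?W"
    then obtain va vb where "a = (\<Sum>l\<in>{1..m}. va l)" "\<forall>l\<in>{1..m}. va l \<in> X l"
      "b = (\<Sum>l\<in>{1..m}. vb l)" "\<forall>l\<in>{1..m}. vb l \<in> X l" by blast
    then show "a + b \<in> ?W"
      using sub by (auto intro!: exI[of _ "\<lambda>l. va l + vb l"] simp: subspace_add sum.distrib)
  next
    fix r :: real and a assume "a \<in> ?W"
    then obtain va where "a = (\<Sum>l\<in>{1..m}. va l)" "\<forall>l\<in>{1..m}. va l \<in> X l" by blast
    then show "r *\<^sub>R a \<in> ?W"
      using sub by (auto intro!: exI[of _ "\<lambda>l. r *\<^sub>R va l"] simp: subspace_scale scaleR_sum_right)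
  qed
  moreover have "(\<Union>l\<in>{1..m}. X l) \<subseteq> ?W"
  proof
    fix w assume "w \<in> (\<Union>l\<in>{1..m}. X l)"
    then obtain i where i: "i \<in> {1..m}" "w \<in> X i" by blast
    then have "w = (\<Sum>l\<in>{1..m}. if l = i then w else 0)" by simp
    moreover have "\<forall>l\<in>{1..m}. (if l = i then w else 0) \<in> X l"
      using i sub by (simp add: subspace_0)
    ultimately show "w \<in> ?W" by blast
  qed
  ultimately have "span (\<Union>l\<in>{1..m}. X l) \<subseteq> ?W" by (simp add: span_minimal)
  then have "u \<in> ?W" using assms by (auto simp: orthogonal_blocks_def)
  then show ?thesis by blast
qed

lemma blk_in:
  assumes "orthogonal_blocks X m" "i \<in> {1..m}"
  shows "blk X i u \<in> X i"
  using orthogonal_blocks_decomp[OF assms(1), of u] blk_of_sum[OF assms(1)] assms(2) by metis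

lemma sum_blk:
  assumes "orthogonal_blocks X m"
  shows "(\<Sum>i\<in>{1..m}. blk X i u) = u"
proof -
  obtain v where "\<forall>l\<in>{1..m}. v l \<in> X l" "u = (\<Sum>l\<in>{1..m}. v l)"
    using orthogonal_blocks_decomp[OF assms, of u] by blast
  then show ?thesis using blk_of_sum[OF assms, of v] by simp
qed

lemma inner_blk:
  assumes "orthogonal_blocks X m"
  shows "u \<bullet> w = (\<Sum>i\<in>{1..m}. blk X i u \<bullet> blk X i w)"
proof -
  have "blk X i u \<bullet> blk X l w = 0" if "i \<in> {1..m}" "l \<in> {1..m}" "i \<noteq> l" for i l
    using assms blk_in[OF assms] that unfolding orthogonal_blocks_def orthogonal_def by blast
  then have "(\<Sum>l\<in>{1..m}. blk X i u \<bullet> blk X l w) = blk X i u \<bullet> blk X i w" if "i \<in> {1..m}" for i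
    using that by (subst sum.remove[of _ i]) auto
  moreover have "u \<bullet> w = (\<Sum>i\<in>{1..m}. \<Sum>l\<in>{1..m}. blk X i u \<bullet> blk X l w)"
    using sum_blk[OF assms, of u] sum_blk[OF assms, of w]
    by (simp flip: inner_sum_left inner_sum_right)
  ultimately show ?thesis by simp
qed

text \<open>The vector \<open>(u\<^sub>1, \<dots>, u\<^bsub>i-1\<^esub>, 0, v\<^bsub>i+1\<^esub>, \<dots>, v\<^sub>m)\<close>; adding \<open>t \<in> X i\<close> fills in the \<open>i\<close>-th entry.\<close>

definition around :: "(nat \<Rightarrow> 'a::euclidean_space set) \<Rightarrow> nat \<Rightarrow> nat \<Rightarrow> 'a \<Rightarrow> 'a \<Rightarrow> 'a" where
  "around X m i u v = (\<Sum>l\<in>{1..<i}. blk X l u) + (\<Sum>l\<in>{i<..m}. blk X l v)"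

definition psd_on :: "'a::euclidean_space set \<Rightarrow> ('a \<Rightarrow> 'a) \<Rightarrow> bool" where
  "psd_on V H \<longleftrightarrow> linear H \<and> H ` V \<subseteq> V \<and>
     (\<forall>u\<in>V. \<forall>v\<in>V. H u \<bullet> v = u \<bullet> H v) \<and> (\<forall>u\<in>V. 0 \<le> u \<bullet> H u)"

abbreviation psd :: "('a::euclidean_space \<Rightarrow> 'a) \<Rightarrow> bool" where
  "psd \<equiv> psd_on UNIV"

definition pos_def :: "('a::euclidean_space \<Rightarrow> 'a) \<Rightarrow> bool" where
  "pos_def H \<longleftrightarrow> psd H \<and> (\<forall>u. u \<noteq> 0 \<longrightarrow> 0 < u \<bullet> H u)"

definition psd_sqrt :: "('a::euclidean_space \<Rightarrow> 'a) \<Rightarrow> 'a \<Rightarrow> 'a" where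
  "psd_sqrt H = (THE R. psd R \<and> R \<circ> R = H)"

definition sqn :: "('a::euclidean_space \<Rightarrow> 'a) \<Rightarrow> 'a \<Rightarrow> real" where
  "sqn H u = u \<bullet> H u"

definition Diag :: "(nat \<Rightarrow> 'a::euclidean_space set) \<Rightarrow> nat \<Rightarrow> (nat \<Rightarrow> 'a \<Rightarrow> 'a) \<Rightarrow> 'a \<Rightarrow> 'a" where
  "Diag X m S u = (\<Sum>i\<in>{1..m}. S i (blk X i u))"

definition diag_part :: "(nat \<Rightarrow> 'a::euclidean_space set) \<Rightarrow> nat \<Rightarrow> ('a \<Rightarrow> 'a) \<Rightarrow> 'a \<Rightarrow> 'a" where
  "diag_part X m H u = (\<Sum>i\<in>{1..m}. blk X i (H (blk X i u)))"

definition upper_part :: "(nat \<Rightarrow> 'a::euclidean_space set) \<Rightarrow> nat \<Rightarrow> ('a \<Rightarrow> 'a) \<Rightarrow> 'a \<Rightarrow> 'a" where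
  "upper_part X m H u = (\<Sum>i\<in>{1..m}. \<Sum>j\<in>{i<..m}. blk X i (H (blk X j u)))"

definition sGS :: "(nat \<Rightarrow> 'a::euclidean_space set) \<Rightarrow> nat \<Rightarrow> ('a \<Rightarrow> 'a) \<Rightarrow> 'a \<Rightarrow> 'a" where
  "sGS X m H = upper_part X m H \<circ> inv (diag_part X m H) \<circ> adjoint (upper_part X m H)"

definition epigraph_on :: "'a::euclidean_space set \<Rightarrow> ('a \<Rightarrow> ereal) \<Rightarrow> ('a \<times> real) set" where
  "epigraph_on V h = {(u, r). u \<in> V \<and> h u \<le> ereal r}"

definition closed_proper_convex_on :: "'a::euclidean_space set \<Rightarrow> ('a \<Rightarrow> ereal) \<Rightarrow> bool" where
  "closed_proper_convex_on V h \<longleftrightarrow>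
     (\<forall>u\<in>V. h u \<noteq> -\<infinity>) \<and> (\<exists>u\<in>V. h u \<noteq> \<infinity>) \<and>
     convex (epigraph_on V h) \<and> closed (epigraph_on V h)"

definition subdiff :: "'a::euclidean_space set \<Rightarrow> ('a \<Rightarrow> ereal) \<Rightarrow> 'a \<Rightarrow> 'a set" where
  "subdiff V h u = {g \<in> V. \<forall>v\<in>V. h u + ereal (g \<bullet> (v - u)) \<le> h v}"

definition smooth_convex :: "('a::euclidean_space \<Rightarrow> real) \<Rightarrow> ('a \<Rightarrow> 'a) \<Rightarrow> bool" where
  "smooth_convex f Df \<longleftrightarrow> convex_on UNIV f \<and> (\<forall>u. GDERIV f u :> Df u) \<and>
     continuous_on UNIV Df \<and> (\<exists>L. L-lipschitz_on UNIV Df)"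

definition majorant :: "('a::euclidean_space \<Rightarrow> real) \<Rightarrow> ('a \<Rightarrow> 'a) \<Rightarrow> ('a \<Rightarrow> 'a) \<Rightarrow> 'a \<Rightarrow> 'a \<Rightarrow> real" where
  "majorant f Df \<Sigma>f u u' = f u' + Df u' \<bullet> (u - u') + 1/2 * sqn \<Sigma>f (u - u')"

text \<open>
  One block step: \<open>v \<in> V\<close> approximately minimizes \<open>t \<mapsto> h (b + t) + 1/2 \<parallel>t - t\<^sub>0\<parallel>\<^sup>2\<close> (seminorm of \<open>S\<close>)
  over \<open>V\<close>, with error vector \<open>e\<close>, where \<open>b\<close> carries the other blocks.
\<close>

definition block_step ::
  "'a::euclidean_space set \<Rightarrow> ('a \<Rightarrow> ereal) \<Rightarrow> ('a \<Rightarrow> 'a) \<Rightarrow> real \<Rightarrow> 'a \<Rightarrow> 'a \<Rightarrow> 'a \<Rightarrow> 'a \<Rightarrow> bool" where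
  "block_step V h S \<epsilon> b t0 v e \<longleftrightarrow> v \<in> V \<and>
     e \<in> {g + S (v - t0) | g. g \<in> subdiff V (\<lambda>t. h (b + t)) v} \<and> norm e \<le> \<epsilon>"

definition backward_step where
  "backward_step X m h S \<epsilon> u ut i v e \<longleftrightarrow>
     block_step (X i) h (S i) \<epsilon> (around X m i u ut) (blk X i u) v e"

definition forward_step where
  "forward_step X m h S \<epsilon> u ut u' i v e \<longleftrightarrow>
     block_step (X i) h (S i) \<epsilon> (around X m i u' ut) (blk X i u) v e"

text \<open>
  A symmetric sweep from \<open>u\<close> to \<open>u'\<close> with intermediate point \<open>ut\<close> and error vectors \<open>dt\<close> (backward)
  and \<open>d\<close> (forward). The first block of \<open>ut\<close> is never computed and never used.
\<close>

definition sweep where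
  "sweep X m h S \<epsilon> u ut u' dt d \<longleftrightarrow>
     (\<forall>i\<in>{2..m}. backward_step X m h S \<epsilon> u ut i (blk X i ut) (blk X i dt)) \<and>
     (\<forall>i\<in>{1..m}. forward_step X m h S \<epsilon> u ut u' i (blk X i u') (blk X i d)) \<and>
     blk X 1 dt = blk X 1 d"

text \<open>The sweep never gets stuck, whatever choices were made in the block steps already performed.\<close>

definition sweep_executable where
  "sweep_executable X m h S \<epsilon> u \<longleftrightarrow>
     (\<forall>i\<in>{2..m}. \<forall>ut dt.
        (\<forall>l\<in>{i<..m}. backward_step X m h S \<epsilon> u ut l (blk X l ut) (blk X l dt))
        \<longrightarrow> (\<exists>v e. backward_step X m h S \<epsilon> u ut i v e)) \<and>
     (\<forall>i\<in>{1..m}. \<forall>ut dt u' d.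
        (\<forall>l\<in>{2..m}. backward_step X m h S \<epsilon> u ut l (blk X l ut) (blk X l dt)) \<and>
        (\<forall>l\<in>{1..<i}. forward_step X m h S \<epsilon> u ut u' l (blk X l u') (blk X l d))
        \<longrightarrow> (\<exists>v e. forward_step X m h S \<epsilon> u ut u' i v e))"

text \<open>The factors \<open>\<kappa>\<close> and \<open>\<kappa>'\<close>, as functions of the block operator\<close>

definition err_const :: "(nat \<Rightarrow> 'a::euclidean_space set) \<Rightarrow> nat \<Rightarrow> ('a \<Rightarrow> 'a) \<Rightarrow> real" where
  "err_const X m H =
     2 * sqrt (real (m - 1)) * onorm (inv (psd_sqrt (diag_part X m H))) +
     sqrt (real m) * onorm (psd_sqrt (diag_part X m H) \<circ>
                            inv (\<lambda>u. diag_part X m H u + upper_part X m H u))"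

text \<open>The vectors \<open>d\<^sub>x\<close> and \<open>d\<^sub>y\<close>, as functions of the block operator and the two error vectors\<close>

definition err_vec :: "(nat \<Rightarrow> 'a::euclidean_space set) \<Rightarrow> nat \<Rightarrow> ('a \<Rightarrow> 'a) \<Rightarrow> 'a \<Rightarrow> 'a \<Rightarrow> 'a" where
  "err_vec X m H d dt = d + upper_part X m H (inv (diag_part X m H) (d - dt))"

text \<open>Both sides of the problem use the same operators: with data \<open>(X, m, \<Sigma>, A, S)\<close> these are
  \<open>M\<close>-tilde, \<open>S\<close>-hat, \<open>M\<close>-hat, and with \<open>(Y, n, \<Sigma>, B, T)\<close> they are \<open>N\<close>-tilde, \<open>T\<close>-hat, \<open>N\<close>-hat.\<close>

definition M_tilde :: "(nat \<Rightarrow> 'a::euclidean_space set) \<Rightarrow> nat \<Rightarrow> ('a \<Rightarrow> 'a) \<Rightarrow> ('z::euclidean_space \<Rightarrow> 'a)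
    \<Rightarrow> real \<Rightarrow> (nat \<Rightarrow> 'a \<Rightarrow> 'a) \<Rightarrow> 'a \<Rightarrow> 'a" where
  "M_tilde X m \<Sigma> A \<sigma> S = (\<lambda>u. \<Sigma> u + \<sigma> *\<^sub>R A (adjoint A u) + Diag X m S u)"

definition S_hat :: "(nat \<Rightarrow> 'a::euclidean_space set) \<Rightarrow> nat \<Rightarrow> ('a \<Rightarrow> 'a) \<Rightarrow> ('z::euclidean_space \<Rightarrow> 'a)
    \<Rightarrow> real \<Rightarrow> (nat \<Rightarrow> 'a \<Rightarrow> 'a) \<Rightarrow> 'a \<Rightarrow> 'a" where
  "S_hat X m \<Sigma> A \<sigma> S = (\<lambda>u. Diag X m S u + sGS X m (M_tilde X m \<Sigma> A \<sigma> S) u)"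

definition M_hat :: "(nat \<Rightarrow> 'a::euclidean_space set) \<Rightarrow> nat \<Rightarrow> ('a \<Rightarrow> 'a) \<Rightarrow> ('z::euclidean_space \<Rightarrow> 'a)
    \<Rightarrow> real \<Rightarrow> (nat \<Rightarrow> 'a \<Rightarrow> 'a) \<Rightarrow> 'a \<Rightarrow> 'a" where
  "M_hat X m \<Sigma> A \<sigma> S = (\<lambda>u. \<Sigma> u + \<sigma> *\<^sub>R A (adjoint A u) + S_hat X m \<Sigma> A \<sigma> S u)"

text \<open>\<open>F\<close> and \<open>G\<close> stand for the majorants of \<open>f\<close> and \<open>g\<close> at the current iterate, \<open>z\<close> for its multiplier.\<close>

definition aug_lagrangian :: "('x::euclidean_space \<Rightarrow> ereal) \<Rightarrow> ('x \<Rightarrow> real)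
    \<Rightarrow> ('y::euclidean_space \<Rightarrow> ereal) \<Rightarrow> ('y \<Rightarrow> real)
    \<Rightarrow> ('z::euclidean_space \<Rightarrow> 'x) \<Rightarrow> ('z \<Rightarrow> 'y) \<Rightarrow> 'z \<Rightarrow> real \<Rightarrow> 'z \<Rightarrow> 'x \<Rightarrow> 'y \<Rightarrow> ereal" where
  "aug_lagrangian p F q G A B c \<sigma> z u v =
     (let r = adjoint A u + adjoint B v - c in
      p u + ereal (F u) + q v + ereal (G v) + ereal (z \<bullet> r) + ereal (\<sigma> / 2 * (norm r)\<^sup>2))"

end

theory Submission
  imports Defs
begin

text \<open>
  Write \<open>M = D + U + U\<^sup>*\<close> for \<open>M\<close>-tilde. The backward sweep enters the forward sweep only through \<open>U\<close>
  applied to the intermediate point, and the backward equations express that point as the new iterate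
  plus \<open>D\<^sup>-\<^sup>1\<close> of known terms. Eliminating it turns the block conditions into a single inclusion whose
  proximal operator is enlarged by \<open>U D\<^sup>-\<^sup>1 U\<^sup>* = sGS(M)\<close> and whose error is \<open>d + U D\<^sup>-\<^sup>1 (d - dt)\<close>.
  The error bound follows from \<open>M + sGS(M) = (D + U) D\<^sup>-\<^sup>1 (D + U\<^sup>*)\<close>: it makes the norm of
  \<open>(M + sGS(M))\<^sup>-\<^sup>1\<^sup>/\<^sup>2 v\<close> equal to that of \<open>D\<^sup>1\<^sup>/\<^sup>2 (D + U)\<^sup>-\<^sup>1 v\<close>, and
  \<open>(D + U)\<^sup>-\<^sup>1 (d + U D\<^sup>-\<^sup>1 (d - dt)) = (D + U)\<^sup>-\<^sup>1 dt + D\<^sup>-\<^sup>1 (d - dt)\<close>. Block subproblems are solvable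
  because their quadratic part is positive definite on the block.
\<close>

text \<open>Letting s tend to 0 in c \<le> s k. This turns a first-order argument, after division by
  s, into an inequality without its quadratic remainder.\<close>

lemma nonpos_if_le_small_multiples:
  fixes c k :: real
  assumes "\<And>s. 0 < s \<Longrightarrow> s \<le> 1 \<Longrightarrow> c \<le> s * k"
  shows "c \<le> 0"
proof (rule ccontr)
  assume c: "\<not> c \<le> 0"
  \<comment> \<open>With this choice s (c + |k|) = c/2, so c \<le> s k would give c \<le>
    c/2.\<close>
  define s where "s = c / (2 * (c + \<bar>k\<bar>))"
  have "0 < s" "s \<le> 1" using c by (auto simp: s_def divide_simps)
  hence "c \<le> s * k" by (rule assms)
  also have "\<dots> \<le> s * (c + \<bar>k\<bar>)" using \<open>0 < s\<close> c by (intro mult_left_mono) auto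
  also have "\<dots> = c / 2" using c by (auto simp: s_def divide_simps)
  finally show False using c by simp
qed

subsection \<open>Positive semidefinite operators and their square roots\<close>

lemma psd_onD:
  assumes "psd_on V H"
  shows "linear H" "u \<in> V \<Longrightarrow> H u \<in> V" "u \<in> V \<Longrightarrow> v \<in> V \<Longrightarrow> H u \<bullet> v = u \<bullet> H v"
    "u \<in> V \<Longrightarrow> 0 \<le> u \<bullet> H u"
  using assms by (auto simp: psd_on_def)

text \<open>Moving from \<open>u\<close> by \<open>- s *\<^sub>R H u\<close> changes the form by -2
  s |H u|^2 to first order. Since the form vanishes at \<open>u\<close> and is nonnegative on
  \<open>V\<close>, this term must be zero.\<close>

lemma psd_on_quadratic_zero:
  assumes H: "psd_on V H" and V: "subspace V" and u: "u \<in> V" and z: "u \<bullet> H u = 0"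
  shows "H u = 0"
proof -
  note lin = psd_onD(1)[OF H]
  define w where "w = H u"
  have w: "w \<in> V" using psd_onD(2)[OF H u] by (simp add: w_def)
  have "2 * (w \<bullet> w) \<le> s * (w \<bullet> H w)" if "0 < s" "s \<le> 1" for s
  proof -
    have "u - s *\<^sub>R w \<in> V" using V u w by (simp add: subspace_diff subspace_scale)
    hence "0 \<le> (u - s *\<^sub>R w) \<bullet> H (u - s *\<^sub>R w)" by (rule psd_onD(4)[OF H])
    also have "\<dots> = - (2 * s * (w \<bullet> w)) + s * s * (w \<bullet> H w)"
      using psd_onD(3)[OF H u w] z
      by (simp add: linear_diff[OF lin] linear_scale[OF lin] inner_diff_left inner_diff_right
          w_def inner_commute algebra_simps)
    finally have "s * (2 * (w \<bullet> w)) \<le> s * (s * (w \<bullet> H w))" by simp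
    thus ?thesis using that by simp
  qed
  hence "2 * (w \<bullet> w) \<le> 0" by (rule nonpos_if_le_small_multiples)
  moreover have "0 \<le> w \<bullet> w" by (rule inner_ge_zero)
  ultimately have "w \<bullet> w = 0" by linarith
  thus ?thesis by (simp add: w_def)
qed

section \<open>Spectral theorem on an invariant subspace\<close>

text \<open>Maximize the quadratic form of \<open>T\<close> over the unit sphere of
  \<open>V\<close>, with maximum c at u. Then c I - T is positive semidefinite on \<open>V\<close>
  and its form vanishes at u, so it annihilates u.\<close>

lemma self_adjoint_eigenvector:
  fixes T :: "'a::euclidean_space \<Rightarrow> 'a"
  assumes T: "linear T" and V: "subspace V" "T ` V \<subseteq> V" "V \<noteq> {0}"
    and sym: "\<And>u v. u \<in> V \<Longrightarrow> v \<in> V \<Longrightarrow> T u \<bullet> v = u \<bullet> T v"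
  shows "\<exists>u\<in>V. norm u = 1 \<and> (\<exists>c. T u = c *\<^sub>R u)"
proof -
  define K where "K = V \<inter> sphere 0 1"
  have "compact K" unfolding K_def
    using closed_subspace[OF V(1)] by (intro closed_Int_compact) auto
  obtain v where v: "v \<in> V" "v \<noteq> 0" using V(1,3) subspace_0 by blast
  have "v /\<^sub>R norm v \<in> K" using v V(1) by (simp add: K_def subspace_scale)
  hence "K \<noteq> {}" by blast
  moreover have "continuous_on K (\<lambda>u. u \<bullet> T u)"
    by (intro continuous_intros linear_continuous_on) (use T in \<open>simp add: linear_linear\<close>)
  ultimately obtain u where u: "u \<in> K" and max: "\<And>w. w \<in> K \<Longrightarrow> w \<bullet> T w \<le> u \<bullet> T u"
    using continuous_attains_sup[OF \<open>compact K\<close>] by blast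
  define c where "c = u \<bullet> T u"
  have uV: "u \<in> V" "norm u = 1" using u by (auto simp: K_def)
  have le: "w \<bullet> T w \<le> c * (w \<bullet> w)" if "w \<in> V" for w
  proof (cases "w = 0")
    case False
    have "w /\<^sub>R norm w \<in> K" using that False V(1) by (simp add: K_def subspace_scale)
    from max[OF this] have "(w \<bullet> T w) / (norm w)\<^sup>2 \<le> c"
      by (simp add: c_def linear_scale[OF T] power2_eq_square divide_simps mult.commute)
    thus ?thesis using False by (simp add: divide_simps dot_square_norm mult.commute)
  qed simp
  have "psd_on V (\<lambda>w. c *\<^sub>R w - T w)"
    unfolding psd_on_def
  proof (intro conjI ballI)
    show "linear (\<lambda>w. c *\<^sub>R w - T w)"
      by (intro linear_compose_sub linear_compose_scale_right linear_id T linear_ident)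
    show "(\<lambda>w. c *\<^sub>R w - T w) ` V \<subseteq> V"
      using V by (auto intro!: subspace_diff subspace_scale)
  qed (use le sym in \<open>auto simp: inner_diff_left inner_diff_right\<close>)
  moreover have "u \<bullet> (c *\<^sub>R u - T u) = 0"
    using uV by (simp add: inner_diff_right c_def dot_square_norm)
  ultimately have "c *\<^sub>R u - T u = 0" using psd_on_quadratic_zero V(1) uV(1) by blast
  hence "T u = c *\<^sub>R u" by simp
  thus ?thesis using uV by blast
qed

text \<open>Induction on the dimension: split off one unit eigenvector u. By symmetry
  \<open>T\<close> maps the orthogonal complement of u in \<open>V\<close> into itself. The
  invariant subspace is kept general for the sake of this induction.\<close>

theorem self_adjoint_eigenbasis:
  fixes T :: "'a::euclidean_space \<Rightarrow> 'a"
  assumes T: "linear T" and V: "subspace V" "T ` V \<subseteq> V"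
    and sym: "\<And>u v. u \<in> V \<Longrightarrow> v \<in> V \<Longrightarrow> T u \<bullet> v = u \<bullet> T v"
  shows "\<exists>B. finite B \<and> span B = V \<and> pairwise orthogonal B \<and>
    (\<forall>b\<in>B. norm b = 1 \<and> (\<exists>c. T b = c *\<^sub>R b))"
  using V sym
proof (induction "dim V" arbitrary: V rule: less_induct)
  case less
  show ?case
  proof (cases "V = {0}")
    case True
    show ?thesis using True by (intro exI[of _ "{}"]) auto
  next
    case False
    obtain u c where u: "u \<in> V" "norm u = 1" "T u = c *\<^sub>R u"
      using self_adjoint_eigenvector[OF T less.prems(1,2) False less.prems(3)] by blast
    define W where "W = V \<inter> {w. u \<bullet> w = 0}"
    have subW: "subspace W" unfolding W_def
      by (intro subspace_inter less.prems subspace_hyperplane)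
    have uu: "u \<bullet> u = 1" using u by (simp add: dot_square_norm)
    have "u \<notin> W" using uu by (simp add: W_def)
    moreover have "W \<subseteq> V" by (auto simp: W_def)
    ultimately have "W \<subset> V" using u(1) by blast
    hence "dim W < dim V"
      using dim_psubset[of W V] subW less.prems(1) by (simp add: span_eq_iff[THEN iffD2])
    moreover have "T ` W \<subseteq> W"
      using less.prems(2,3) u by (auto simp: W_def simp flip: less.prems(3))
    ultimately obtain B where B: "finite B" "span B = W" "pairwise orthogonal B"
      "\<forall>b\<in>B. norm b = 1 \<and> (\<exists>c. T b = c *\<^sub>R b)"
      using less.hyps[of W] subW less.prems(3) unfolding W_def by blast
    have BW: "b \<in> W" if "b \<in> B" for b using B(2) span_base[OF that] by simp
    have "span (insert u B) = V"
    proof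
      show "span (insert u B) \<subseteq> V"
        using u BW less.prems(1) by (intro span_minimal) (auto simp: W_def)
      show "V \<subseteq> span (insert u B)"
      proof
        fix v assume "v \<in> V"
        hence "v - (u \<bullet> v) *\<^sub>R u \<in> W" using less.prems(1) u uu
          by (auto simp: W_def inner_diff_right intro!: subspace_diff subspace_scale)
        hence "v - (u \<bullet> v) *\<^sub>R u \<in> span B" using B(2) by simp
        thus "v \<in> span (insert u B)" by (auto simp: span_insert)
      qed
    qed
    moreover have "pairwise orthogonal (insert u B)"
      using B(3) BW by (auto simp: pairwise_insert W_def orthogonal_def inner_commute)
    ultimately show ?thesis using B(1,4) u by (intro exI[of _ "insert u B"]) auto
  qed
qed

text \<open>In an orthonormal eigenbasis, scale each basis vector by the root of its
  eigenvalue.\<close>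

lemma psd_sqrt_exists:
  fixes H :: "'a::euclidean_space \<Rightarrow> 'a"
  assumes H: "psd H"
  shows "\<exists>R. psd R \<and> R \<circ> R = H"
proof -
  have "\<exists>B. finite B \<and> span B = UNIV \<and> pairwise orthogonal B \<and>
    (\<forall>b\<in>B. norm b = 1 \<and> (\<exists>c. H b = c *\<^sub>R b))"
    by (rule self_adjoint_eigenbasis) (use psd_onD[OF H] in auto)
  then obtain B where B: "finite B" "span B = UNIV" "pairwise orthogonal B"
    and eig: "\<forall>b\<in>B. norm b = 1 \<and> (\<exists>c. H b = c *\<^sub>R b)" by blast
  then obtain c where c: "\<And>b. b \<in> B \<Longrightarrow> H b = c b *\<^sub>R b" by metis
  have bb: "b \<bullet> b' = (if b = b' then 1 else 0)" if "b \<in> B" "b' \<in> B" for b b'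
    using B(3) eig that by (auto simp: pairwise_def orthogonal_def dot_square_norm)
  have c0: "0 \<le> c b" if "b \<in> B" for b
    using psd_onD(4)[OF H, of b] that c bb by simp
  have expand: "(\<Sum>b\<in>B. (u \<bullet> b) *\<^sub>R b) = u" for u
    using orthonormal_basis_expand[OF B(3)] eig B by auto
  define R where "R u = (\<Sum>b\<in>B. sqrt (c b) *\<^sub>R ((u \<bullet> b) *\<^sub>R b))" for u
  have linR: "linear R" unfolding R_def
    by (intro linear_compose_sum ballI linear_compose_scale_right)
      (auto intro!: linearI simp: inner_add_left algebra_simps)
  have Ru: "R u \<bullet> v = (\<Sum>b\<in>B. sqrt (c b) * ((u \<bullet> b) * (b \<bullet> v)))" for u v
    by (simp add: R_def inner_sum_left mult.assoc)
  have Rb: "R u \<bullet> b = sqrt (c b) * (u \<bullet> b)" if "b \<in> B" for u b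
    using that B(1) by (simp add: Ru bb if_distrib sum.delta cong: if_cong)
  have "R (R u) = H u" for u
  proof -
    have "R (R u) = (\<Sum>b\<in>B. (u \<bullet> b) *\<^sub>R H b)"
      unfolding R_def[of "R u"]
      by (rule sum.cong) (auto simp: Rb c c0 simp flip: mult.assoc mult.commute[of "u \<bullet> _"])
    also have "\<dots> = H (\<Sum>b\<in>B. (u \<bullet> b) *\<^sub>R b)"
      using psd_onD(1)[OF H] by (simp add: linear_sum linear_scale)
    finally show ?thesis by (simp add: expand)
  qed
  moreover have "psd R"
    unfolding psd_on_def
  proof (intro conjI ballI)
    show "R u \<bullet> v = u \<bullet> R v" for u v
      by (subst inner_commute[of u]) (simp only: Ru, simp add: inner_commute mult.commute)
    show "0 \<le> u \<bullet> R u" for u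
      by (subst inner_commute, simp only: Ru) (auto simp: c0 inner_commute intro!: sum_nonneg)
  qed (use linR in auto)
  ultimately show ?thesis by (intro exI[of _ R]) auto
qed

text \<open>Take an eigenvector b of T = R - P with eigenvalue c. Then c (<b,Rb> + <b,Pb>) = |Rb|^2
  - |Pb|^2 = <b,(R^2 - P^2)b> = 0. Either c = 0, or both forms vanish at b and hence Rb = Pb = 0. So
  T vanishes on an eigenbasis, and R and P need not be shown to commute.\<close>

lemma psd_sqrt_unique:
  fixes R P :: "'a::euclidean_space \<Rightarrow> 'a"
  assumes R: "psd R" and P: "psd P" and eq: "R \<circ> R = P \<circ> P"
  shows "R = P"
proof -
  define T where "T u = R u - P u" for u
  have linT: "linear T" unfolding T_def
    using psd_onD(1)[OF R] psd_onD(1)[OF P] by (rule linear_compose_sub)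
  have "\<exists>B. finite B \<and> span B = UNIV \<and> pairwise orthogonal B \<and>
    (\<forall>b\<in>B. norm b = 1 \<and> (\<exists>c. T b = c *\<^sub>R b))"
    by (rule self_adjoint_eigenbasis[OF linT])
      (use psd_onD(3)[OF R] psd_onD(3)[OF P] in \<open>auto simp: T_def inner_diff_left inner_diff_right\<close>)
  then obtain B where B: "span B = UNIV" and eig: "\<forall>b\<in>B. \<exists>c. T b = c *\<^sub>R b" by blast
  have "T b = 0" if b: "b \<in> B" for b
  proof -
    obtain c where c: "T b = c *\<^sub>R b" using eig b by blast
    have RP: "R (R b) = P (P b)" using eq by (metis comp_apply)
    have "c * (b \<bullet> R b + b \<bullet> P b) = T b \<bullet> (R b + P b)"
      by (simp add: c inner_add_right distrib_left)
    also have "\<dots> = R b \<bullet> R b - P b \<bullet> P b"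
      by (simp add: T_def inner_diff_left inner_add_right inner_commute[of "P b" "R b"])
    also have "\<dots> = b \<bullet> R (R b) - b \<bullet> P (P b)"
      using psd_onD(3)[OF R] psd_onD(3)[OF P] by simp
    finally have "c = 0 \<or> b \<bullet> R b + b \<bullet> P b = 0" by (simp add: RP)
    thus ?thesis
    proof
      assume "b \<bullet> R b + b \<bullet> P b = 0"
      hence "b \<bullet> R b = 0" "b \<bullet> P b = 0"
        using psd_onD(4)[OF R, of b] psd_onD(4)[OF P, of b] by auto
      hence "R b = 0" "P b = 0" using psd_on_quadratic_zero[OF R] psd_on_quadratic_zero[OF P] by auto
      thus ?thesis by (simp add: T_def)
    qed (simp add: c)
  qed
  hence "T u = 0" for u
    using linear_eq_0_on_span[OF linT, of B u] B by simp
  thus ?thesis by (simp add: T_def fun_eq_iff)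
qed

lemma psd_sqrt:
  assumes "psd H"
  shows "psd (psd_sqrt H)" "psd_sqrt H (psd_sqrt H u) = H u"
proof -
  obtain R where R: "psd R" "R \<circ> R = H" using psd_sqrt_exists[OF assms] by blast
  have "psd_sqrt H = R"
    unfolding psd_sqrt_def
  proof (rule the_equality)
    fix P assume P: "psd P \<and> P \<circ> P = H"
    show "P = R" by (rule psd_sqrt_unique) (use P R in simp_all)
  qed (use R in simp)
  thus "psd (psd_sqrt H)" "psd_sqrt H (psd_sqrt H u) = H u"
    using R(1) fun_cong[OF R(2), of u] by simp_all
qed

section \<open>Inverses of positive definite operators and of their roots\<close>

lemma linear_bij_if_kernel_trivial:
  fixes F :: "'a::euclidean_space \<Rightarrow> 'a"
  assumes "linear F" "\<And>u. F u = 0 \<Longrightarrow> u = 0"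
  shows "bij F" "linear (inv F)"
proof -
  have inj: "inj F" using assms linear_injective_0 by blast
  show "bij F" using inj assms(1) by (simp add: bij_def linear_injective_imp_surjective)
  show "linear (inv F)" using assms(1) inj by (rule inj_linear_imp_inv_linear)
qed

lemma bij_inv_simps:
  assumes "bij F"
  shows "F (inv F u) = u" "inv F (F u) = u"
  using assms by (auto simp: bij_def surj_f_inv_f inv_f_f)

lemma pos_def_bij:
  assumes "pos_def H"
  shows "bij H" "linear (inv H)"
proof -
  have "linear H" using assms by (simp add: pos_def_def psd_on_def)
  moreover have "u = 0" if "H u = 0" for u using assms that unfolding pos_def_def by force
  ultimately show "bij H" "linear (inv H)" using linear_bij_if_kernel_trivial by blast+
qed

lemma pos_def_sqrt_bij:
  assumes "pos_def H"
  shows "bij (psd_sqrt H)" "linear (inv (psd_sqrt H))"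
proof -
  have H: "psd H" using assms by (simp add: pos_def_def)
  have lin: "linear (psd_sqrt H)" using psd_sqrt(1)[OF H] by (rule psd_onD)
  have "u = 0" if "psd_sqrt H u = 0" for u
  proof -
    have "H u = 0" using psd_sqrt(2)[OF H, of u] that linear_0[OF lin] by simp
    thus ?thesis using assms unfolding pos_def_def by force
  qed
  thus "bij (psd_sqrt H)" "linear (inv (psd_sqrt H))"
    using linear_bij_if_kernel_trivial[OF lin] by blast+
qed

lemma norm_psd_sqrt:
  assumes "psd H"
  shows "norm (psd_sqrt H u) ^ 2 = u \<bullet> H u"
  using psd_onD(3)[OF psd_sqrt(1)[OF assms], of u "psd_sqrt H u"] psd_sqrt(2)[OF assms]
  by (simp add: power2_norm_eq_inner)

text \<open>Cancelling one root in R R H^-1 = I. The power H^(-1/2) is expressed throughout as the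
  inverse of the root, and this lemma links it to H^-1.\<close>

lemma psd_sqrt_inv:
  assumes "pos_def H"
  shows "psd_sqrt H (inv H u) = inv (psd_sqrt H) u"
proof -
  have "psd_sqrt H (psd_sqrt H (inv H u)) = u"
    using assms psd_sqrt(2) pos_def_bij(1) bij_inv_simps(1) by (metis pos_def_def)
  thus ?thesis using bij_inv_simps(2)[OF pos_def_sqrt_bij(1)[OF assms]] by metis
qed

lemma pos_def_inv:
  assumes "pos_def H"
  shows "pos_def (inv H)"
proof -
  have H: "psd H" using assms by (simp add: pos_def_def)
  note b = bij_inv_simps[OF pos_def_bij(1)[OF assms]]
  have sym: "inv H u \<bullet> v = u \<bullet> inv H v" for u v
    using psd_onD(3)[OF H, of "inv H u" "inv H v"] by (simp add: b)
  have pos: "0 < u \<bullet> inv H u" if "u \<noteq> 0" for u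
  proof -
    have "inv H u \<noteq> 0" using that b linear_0[OF psd_onD(1)[OF H]] by metis
    hence "0 < inv H u \<bullet> H (inv H u)" using assms by (simp add: pos_def_def)
    thus ?thesis by (simp add: b inner_commute)
  qed
  have "0 \<le> u \<bullet> inv H u" for u using pos[of u] by (cases "u = 0") auto
  thus ?thesis unfolding pos_def_def psd_on_def using sym pos pos_def_bij(2)[OF assms] by auto
qed

subsection \<open>Blocks\<close>

lemma blk_zero_outside:
  assumes "orthogonal_blocks X m" "i \<in> {1..m}" "j \<in> {1..m}" "i \<noteq> j" "u \<in> X j"
  shows "blk X i u = 0"
  using assms by (intro blk_eqI) (auto simp: orthogonal_blocks_def subspace_0 orthogonal_commute)

lemma blk_same:
  assumes "orthogonal_blocks X m" "i \<in> {1..m}" "u \<in> X i"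
  shows "blk X i u = u"
  using assms by (intro blk_eqI) (auto simp: orthogonal_blocks_def orthogonal_def)

lemma blk_blk:
  assumes "orthogonal_blocks X m" "i \<in> {1..m}" "j \<in> {1..m}"
  shows "blk X i (blk X j u) = (if i = j then blk X j u else 0)"
  using assms blk_zero_outside blk_same blk_in by metis

text \<open>The part of \<open>u\<close> removed by the projection lies in the other blocks, which
  are orthogonal to \<open>w\<close>.\<close>

lemma inner_blk_left:
  assumes "orthogonal_blocks X m" "i \<in> {1..m}" "w \<in> X i"
  shows "blk X i u \<bullet> w = u \<bullet> w"
proof -
  have "blk X l w = 0" if "l \<in> {1..m} - {i}" for l
    using that assms blk_zero_outside by blast
  thus ?thesis
    unfolding inner_blk[OF assms(1), of u w] using assms blk_same[OF assms]
    by (subst sum.remove[of _ i]) auto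
qed

lemma linear_blk:
  assumes "orthogonal_blocks X m" "i \<in> {1..m}"
  shows "linear (blk X i)"
proof (rule linearI)
  have sub: "subspace (X i)" using assms by (auto simp: orthogonal_blocks_def)
  note bi = blk_in[OF assms] and inner = inner_blk_left[OF assms]
  fix u v :: 'a and r :: real
  show "blk X i (u + v) = blk X i u + blk X i v"
    by (rule blk_eqI[of X, OF sub subspace_add[OF sub bi bi]])
      (simp add: orthogonal_def inner_diff_left inner_add_left inner)
  show "blk X i (r *\<^sub>R u) = r *\<^sub>R blk X i u"
    by (rule blk_eqI[of X, OF sub subspace_scale[OF sub bi]])
      (simp add: orthogonal_def inner_diff_left inner)
qed

lemma blk_self_adjoint:
  assumes "orthogonal_blocks X m" "i \<in> {1..m}"
  shows "blk X i u \<bullet> v = u \<bullet> blk X i v"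
  using inner_blk_left[OF assms blk_in[OF assms], of u v]
    inner_blk_left[OF assms blk_in[OF assms], of v u] by (metis inner_commute)

text \<open>Pythagoras over the blocks. The set \<open>J\<close> counts only blocks that may be
  nonzero; this is where sqrt(m-1), rather than sqrt(m), comes from.\<close>

lemma norm_blocks_le:
  assumes X: "orthogonal_blocks X m" and J: "J \<subseteq> {1..m}" and e: "0 \<le> e"
    and le: "\<And>i. i \<in> J \<Longrightarrow> norm (blk X i u) \<le> e"
    and zero: "\<And>i. i \<in> {1..m} - J \<Longrightarrow> blk X i u = 0"
  shows "norm u \<le> sqrt (real (card J)) * e"
proof -
  have "(norm u)\<^sup>2 = (\<Sum>i\<in>{1..m}. (norm (blk X i u))\<^sup>2)"
    by (simp add: power2_norm_eq_inner inner_blk[OF X, of u u])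
  also have "\<dots> = (\<Sum>i\<in>J. (norm (blk X i u))\<^sup>2)"
    using J zero by (intro sum.mono_neutral_right) auto
  also have "\<dots> \<le> (\<Sum>i\<in>J. e\<^sup>2)" using le by (intro sum_mono power_mono) auto
  also have "\<dots> = (sqrt (real (card J)) * e)\<^sup>2" by (simp add: power_mult_distrib)
  finally show ?thesis by (rule power2_le_imp_le) (use e in simp)
qed

lemma psd_Diag:
  assumes X: "orthogonal_blocks X m" and S: "\<forall>i\<in>{1..m}. psd_on (X i) (S i)"
  shows "psd (Diag X m S)"
proof -
  have SX: "S i (blk X i u) \<in> X i" if "i \<in> {1..m}" for i u
    using S blk_in[OF X that] that psd_onD(2) by blast
  have eq: "Diag X m S u \<bullet> v = (\<Sum>i\<in>{1..m}. S i (blk X i u) \<bullet> blk X i v)" for u v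
    unfolding Diag_def inner_sum_left
    using inner_blk_left[OF X _ SX] by (intro sum.cong) (auto simp: inner_commute)
  show ?thesis
    unfolding psd_on_def
  proof (intro conjI ballI)
    show "linear (Diag X m S)"
      unfolding Diag_def
      using S linear_blk[OF X] psd_onD(1) linear_compose[of "blk X _" "S _", unfolded o_def]
      by (intro linear_compose_sum) blast
    have "S i (blk X i u) \<bullet> blk X i v = S i (blk X i v) \<bullet> blk X i u" if "i \<in> {1..m}" for i u v
      using psd_onD(3)[of "X i" "S i" "blk X i u" "blk X i v"] S blk_in[OF X that] that
      by (simp add: inner_commute)
    thus "Diag X m S u \<bullet> v = u \<bullet> Diag X m S v" for u v
      unfolding eq inner_commute[of u] by (intro sum.cong refl)
    have "0 \<le> S i (blk X i u) \<bullet> blk X i u" if "i \<in> {1..m}" for i u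
      using psd_onD(4)[of "X i" "S i" "blk X i u"] S blk_in[OF X that] that
      by (simp add: inner_commute)
    thus "0 \<le> u \<bullet> Diag X m S u" for u
      unfolding eq inner_commute[of u] by (intro sum_nonneg)
  qed auto
qed

lemma blk_Diag:
  assumes X: "orthogonal_blocks X m" and S: "\<forall>i\<in>{1..m}. psd_on (X i) (S i)" and i: "i \<in> {1..m}"
  shows "blk X i (Diag X m S u) = S i (blk X i u)"
  unfolding Diag_def using psd_onD(2) S blk_in[OF X] i by (intro blk_of_sum[OF X _ i]) blast

lemma psd_add:
  assumes "psd H" "psd K"
  shows "psd (\<lambda>u. H u + K u)"
  using psd_onD[OF assms(1)] psd_onD[OF assms(2)]
  unfolding psd_on_def by (auto simp: inner_add_left inner_add_right intro: linear_compose_add)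

lemma psd_scaled_gram:
  fixes A :: "'z::euclidean_space \<Rightarrow> 'a::euclidean_space"
  assumes "linear A" "0 \<le> \<sigma>"
  shows "psd (\<lambda>u. \<sigma> *\<^sub>R A (adjoint A u))"
proof -
  have "linear (\<lambda>u. \<sigma> *\<^sub>R A (adjoint A u))"
    using linear_compose[OF adjoint_linear[OF assms(1)] assms(1)]
    by (intro linear_compose_scale_right) (simp add: o_def)
  moreover have "A (adjoint A u) \<bullet> v = adjoint A u \<bullet> adjoint A v" for u v
    using adjoint_works[OF assms(1)] by simp
  ultimately show ?thesis unfolding psd_on_def using assms(2) by (auto simp: inner_commute)
qed

section \<open>Splitting, factorization and error bound for one block operator\<close>

locale block_operator =
  fixes X :: "nat \<Rightarrow> 'a::euclidean_space set" and m :: nat and M :: "'a \<Rightarrow> 'a"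
  assumes X: "orthogonal_blocks X m"
    and M: "psd M"
    and D_pos: "pos_def (diag_part X m M)"
begin

abbreviation "D \<equiv> diag_part X m M"
abbreviation "U \<equiv> upper_part X m M"
abbreviation "Us \<equiv> adjoint U"

lemma linM: "linear M" using M by (rule psd_onD)

lemma linear_blk_M_blk: "i \<in> {1..m} \<Longrightarrow> j \<in> {1..m} \<Longrightarrow> linear (\<lambda>u. blk X i (M (blk X j u)))"
  using linear_compose[OF linear_compose[OF linear_blk[OF X] linM] linear_blk[OF X]]
  by (simp add: o_def)

lemma linD: "linear D"
  unfolding diag_part_def by (intro linear_compose_sum ballI linear_blk_M_blk)

lemma linU: "linear U"
  unfolding upper_part_def by (intro linear_compose_sum ballI linear_blk_M_blk) auto

lemma linUs: "linear Us" using linU by (rule adjoint_linear)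

lemma Us_inner: "Us u \<bullet> v = u \<bullet> U v" "u \<bullet> Us v = U u \<bullet> v"
  using adjoint_works[OF linU] by (simp_all add: inner_commute)

lemma psdD: "psd D" using D_pos by (simp add: pos_def_def)

text \<open>Testing against an arbitrary v turns each operator into a double sum of block entries:
  diagonal, above it and below it. Symmetry of \<open>M\<close> makes the adjoint of the upper part
  the lower part.\<close>

lemma M_split: "M u = D u + U u + Us u"
proof -
  let ?b = "\<lambda>i j v u. blk X i v \<bullet> M (blk X j u)"
  have Uin: "v \<bullet> U u = (\<Sum>i\<in>{1..m}. \<Sum>j\<in>{i<..m}. ?b i j v u)" for u v
    unfolding upper_part_def inner_sum_right
    by (intro sum.cong refl) (auto simp: blk_self_adjoint[OF X])
  have Din: "v \<bullet> D u = (\<Sum>i\<in>{1..m}. ?b i i v u)" for u v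
    unfolding diag_part_def inner_sum_right
    by (intro sum.cong refl) (auto simp: blk_self_adjoint[OF X])
  have Usin: "v \<bullet> Us u = (\<Sum>i\<in>{1..m}. \<Sum>j\<in>{1..<i}. ?b i j v u)" for u v
  proof -
    have "v \<bullet> Us u = u \<bullet> U v" by (simp add: Us_inner inner_commute)
    also have "\<dots> = (\<Sum>j\<in>{1..m}. \<Sum>i\<in>{j<..m}. ?b i j v u)"
      unfolding Uin using psd_onD(3)[OF M UNIV_I UNIV_I, symmetric]
      by (intro sum.cong refl) (simp add: inner_commute)
    also have "\<dots> = (\<Sum>j\<in>{1..m}. \<Sum>i\<in>{i\<in>{1..m}. j < i}. ?b i j v u)"
      by (intro sum.cong[OF refl] sum.cong[OF _ refl]) auto
    \<comment> \<open>Exchanging the order of summation over the pairs j < i passes from the upper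
      to the lower triangle.\<close>
    also have "\<dots> = (\<Sum>i\<in>{1..m}. \<Sum>j\<in>{j\<in>{1..m}. j < i}. ?b i j v u)"
      by (rule sum.swap_restrict) auto
    also have "\<dots> = (\<Sum>i\<in>{1..m}. \<Sum>j\<in>{1..<i}. ?b i j v u)"
      by (intro sum.cong[OF refl] sum.cong[OF _ refl]) auto
    finally show ?thesis .
  qed
  have "v \<bullet> M u = v \<bullet> (D u + U u + Us u)" for v
  proof -
    have "v \<bullet> M u = (\<Sum>i\<in>{1..m}. blk X i v) \<bullet> M (\<Sum>j\<in>{1..m}. blk X j u)"
      by (simp only: sum_blk[OF X])
    also have "\<dots> = (\<Sum>i\<in>{1..m}. \<Sum>j\<in>{1..m}. ?b i j v u)"
      by (simp add: inner_sum_left inner_sum_right linear_sum[OF linM]) (rule sum.swap)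
    also have "\<dots> = (\<Sum>i\<in>{1..m}. ?b i i v u + (\<Sum>j\<in>{i<..m}. ?b i j v u) + (\<Sum>j\<in>{1..<i}. ?b i j v u))"
    proof (rule sum.cong[OF refl])
      fix i assume i: "i \<in> {1..m}"
      hence "{1..m} = insert i ({i<..m} \<union> {1..<i})" by auto
      thus "(\<Sum>j\<in>{1..m}. ?b i j v u) = ?b i i v u + (\<Sum>j\<in>{i<..m}. ?b i j v u) + (\<Sum>j\<in>{1..<i}. ?b i j v u)"
        by (simp add: sum.union_disjoint[of "{i<..m}" "{Suc 0..<i}"] disjoint_iff)
    qed
    also have "\<dots> = v \<bullet> (D u + U u + Us u)"
      by (simp add: inner_add_right Uin Din Usin sum.distrib)
    finally show ?thesis .
  qed
  thus ?thesis using vector_eq_ldot by blast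
qed

lemma blk_D: "i \<in> {1..m} \<Longrightarrow> blk X i (D u) = blk X i (M (blk X i u))"
  unfolding diag_part_def by (rule blk_of_sum[OF X]) (auto intro: blk_in[OF X])

lemma blk_U: "i \<in> {1..m} \<Longrightarrow> blk X i (U u) = (\<Sum>j\<in>{i<..m}. blk X i (M (blk X j u)))"
proof -
  have "subspace (X i)" if "i \<in> {1..m}" for i using X that by (auto simp: orthogonal_blocks_def)
  thus "i \<in> {1..m} \<Longrightarrow> blk X i (U u) = (\<Sum>j\<in>{i<..m}. blk X i (M (blk X j u)))"
    unfolding upper_part_def by (intro blk_of_sum[OF X] subspace_sum) (auto intro: blk_in[OF X])
qed

text \<open>Obtained by subtraction: the i-th row of \<open>M\<close> is known in full, and
  \<open>M_split\<close> leaves the adjoint as what remains after the diagonal and upper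
  parts.\<close>

lemma blk_Us: "i \<in> {1..m} \<Longrightarrow> blk X i (Us u) = (\<Sum>j\<in>{1..<i}. blk X i (M (blk X j u)))"
proof -
  assume i: "i \<in> {1..m}"
  note lin = linear_blk[OF X i]
  have "blk X i (M u) = (\<Sum>j\<in>{1..m}. blk X i (M (blk X j u)))"
    by (subst sum_blk[OF X, of u, symmetric]) (simp only: linear_sum[OF linM] linear_sum[OF lin])
  moreover have "{1..m} = insert i ({i<..m} \<union> {1..<i})" using i by auto
  ultimately have "blk X i (M u) = blk X i (M (blk X i u)) + (\<Sum>j\<in>{i<..m}. blk X i (M (blk X j u)))
      + (\<Sum>j\<in>{1..<i}. blk X i (M (blk X j u)))"
    by (simp add: sum.union_disjoint[of "{i<..m}" "{Suc 0..<i}"] disjoint_iff)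
  moreover have "blk X i (M u) = blk X i (D u) + blk X i (U u) + blk X i (Us u)"
    by (simp add: M_split linear_add[OF lin])
  ultimately show ?thesis using blk_D[OF i] blk_U[OF i] by simp
qed

text \<open>On vectors of a single block the forms of \<open>M\<close> and \<open>D\<close>
  coincide. Hence every block subproblem is strongly convex although \<open>M\<close> may be
  singular.\<close>

lemma M_pos_block:
  assumes i: "i \<in> {1..m}" and u: "u \<in> X i" "u \<noteq> 0"
  shows "0 < u \<bullet> M u"
proof -
  have "u \<bullet> D u = u \<bullet> blk X i (D u)" using inner_blk_left[OF X i u(1)] by (metis inner_commute)
  also have "\<dots> = u \<bullet> M u"
    using blk_D[OF i, of u] blk_same[OF X i u(1)] inner_blk_left[OF X i u(1)] by (metis inner_commute)
  finally show ?thesis using D_pos u(2) unfolding pos_def_def by metis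
qed

text \<open>Each diagonal block is positive definite on its factor, hence injective. The blockwise
  form is needed because the sweep gives no backward equation for the first block.\<close>

lemma blk_zero_if_D_zero:
  assumes i: "i \<in> {1..m}" and "blk X i (D u) = 0"
  shows "blk X i u = 0"
proof (rule ccontr)
  assume "blk X i u \<noteq> 0"
  hence "0 < blk X i u \<bullet> M (blk X i u)" by (intro M_pos_block[OF i] blk_in[OF X i])
  also have "\<dots> = blk X i u \<bullet> blk X i (M (blk X i u))"
    using inner_blk_left[OF X i blk_in[OF X i]] by (metis inner_commute)
  finally show False using assms(2) by (simp add: blk_D[OF i])
qed

lemma invD: "D (inv D u) = u" "inv D (D u) = u" "linear (inv D)"
  using bij_inv_simps[OF pos_def_bij(1)[OF D_pos]] pos_def_bij(2)[OF D_pos] by auto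

lemma sGS_apply: "sGS X m M u = U (inv D (Us u))"
  by (simp add: sGS_def)

lemma psd_sGS: "psd (sGS X m M)"
proof -
  note Di = pos_def_inv[OF D_pos, unfolded pos_def_def, THEN conjunct1]
  have "linear (sGS X m M)"
    unfolding sGS_def using linU linUs invD(3) by (intro linear_compose)
  thus ?thesis
    unfolding psd_on_def
    using psd_onD(3,4)[OF Di] by (auto simp: sGS_apply Us_inner simp flip: Us_inner)
qed

text \<open>Both summands are nonnegative, so a zero of the form annihilates each. The second one
  gives U^* u = 0, since D^-1 is positive definite; then <u,Mu> reduces to <u,Du>, which forces u =
  0.\<close>

lemma pos_def_M_sGS: "pos_def (\<lambda>u. M u + sGS X m M u)"
proof -
  have psd: "psd (\<lambda>u. M u + sGS X m M u)" using M psd_sGS by (rule psd_add)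
  have "0 < u \<bullet> (M u + sGS X m M u)" if "u \<noteq> 0" for u
  proof (rule ccontr)
    assume "\<not> 0 < u \<bullet> (M u + sGS X m M u)"
    moreover have "0 \<le> u \<bullet> M u" "0 \<le> u \<bullet> sGS X m M u"
      using psd_onD(4)[OF M] psd_onD(4)[OF psd_sGS] by auto
    ultimately have z: "u \<bullet> M u = 0" "Us u \<bullet> inv D (Us u) = 0"
      by (auto simp: inner_add_right sGS_apply Us_inner)
    have "Us u = 0" using z(2) pos_def_inv[OF D_pos] by (force simp: pos_def_def)
    hence "u \<bullet> U u = 0" using Us_inner(1)[of u u] by simp
    hence "u \<bullet> D u = 0" using z(1) \<open>Us u = 0\<close> by (simp add: M_split inner_add_right)
    thus False using D_pos that by (force simp: pos_def_def)
  qed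
  thus ?thesis using psd by (simp add: pos_def_def)
qed

text \<open>If (D + U) u = 0, then <u,Mu> = <u,Du> + 2 <u,Uu> = -<u,Du>, which is negative for
  nonzero u and contradicts \<open>psd M\<close>.\<close>

lemma bij_D_plus_U: "bij (\<lambda>u. D u + U u)" "linear (inv (\<lambda>u. D u + U u))"
proof -
  have lin: "linear (\<lambda>u. D u + U u)" using linD linU by (rule linear_compose_add)
  have "u = 0" if "D u + U u = 0" for u
  proof (rule ccontr)
    assume "u \<noteq> 0"
    hence pos: "0 < u \<bullet> D u" using D_pos by (simp add: pos_def_def)
    have "u \<bullet> (D u + U u) = 0" using that by simp
    moreover have "u \<bullet> M u = u \<bullet> D u + u \<bullet> U u + u \<bullet> U u"
      by (simp add: M_split inner_add_right Us_inner inner_commute)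
    moreover have "0 \<le> u \<bullet> M u" using psd_onD(4)[OF M] by simp
    ultimately show False using pos by (simp add: inner_add_right)
  qed
  thus "bij (\<lambda>u. D u + U u)" "linear (inv (\<lambda>u. D u + U u))"
    using linear_bij_if_kernel_trivial[OF lin] by blast+
qed

text \<open>This rests on the factorization of \<open>M + sGS(M)\<close> as \<open>(D + U) D\<^sup>-\<^sup>1 (D + U\<^sup>*)\<close>.\<close>

lemma norm_inv_sqrt_M_sGS:
  "norm (inv (psd_sqrt (\<lambda>u. M u + sGS X m M u)) d) = norm (psd_sqrt D (inv (\<lambda>u. D u + U u) d))"
proof -
  let ?H = "\<lambda>u. M u + sGS X m M u" and ?F = "\<lambda>u. D u + U u"
  define w where "w = inv ?H d"
  define s where "s = inv D (D w + Us w)"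
  have Hw: "?H w = d"
    using bij_inv_simps(1)[OF pos_def_bij(1)[OF pos_def_M_sGS]] by (simp add: w_def)
  have Ds: "D s = D w + Us w" by (simp add: s_def invD)
  have s: "s = w + inv D (Us w)" by (simp add: s_def linear_add[OF invD(3)] invD)
  have Fs: "?F s = d"
    by (simp add: Ds flip: Hw) (simp add: s linear_add[OF linU] M_split sGS_apply)
  hence "inv ?F d = s" using bij_inv_simps(2)[OF bij_D_plus_U(1)] by metis
  have "(norm (inv (psd_sqrt ?H) d))\<^sup>2 = (norm (psd_sqrt ?H w))\<^sup>2"
    using psd_sqrt_inv[OF pos_def_M_sGS] by (simp add: w_def)
  also have "\<dots> = w \<bullet> ?F s"
    using norm_psd_sqrt[of ?H w] pos_def_M_sGS by (simp add: pos_def_def Fs flip: Hw)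
  also have "\<dots> = D s \<bullet> s"
    using psd_onD(3)[OF psdD] by (simp add: Ds inner_add_right inner_add_left Us_inner)
  also have "\<dots> = (norm (psd_sqrt D s))\<^sup>2"
    using norm_psd_sqrt[OF psdD] by (simp add: inner_commute)
  finally show ?thesis using \<open>inv ?F d = s\<close> by (simp add: power2_eq_iff_nonneg)
qed

text \<open>After (D + U)^-1 the error vector is a sum of two terms, one for each summand of
  \<open>err_const\<close>. The root of \<open>D\<close> times D^-1 is D^(-1/2), which explains the
  first operator norm; the second is applied to \<open>dt\<close> alone.\<close>

lemma norm_err_vec_le:
  assumes m: "1 \<le> m" and e: "0 \<le> e"
    and d: "\<And>i. i \<in> {1..m} \<Longrightarrow> norm (blk X i d) \<le> e"
    and dt: "\<And>i. i \<in> {1..m} \<Longrightarrow> norm (blk X i dt) \<le> e"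
    and 1: "blk X 1 dt = blk X 1 d"
  shows "norm (inv (psd_sqrt (\<lambda>u. M u + sGS X m M u)) (err_vec X m M d dt)) \<le> err_const X m M * e"
proof -
  let ?F = "\<lambda>u. D u + U u"
  let ?R = "psd_sqrt D"
  note linR = psd_onD(1)[OF psd_sqrt(1)[OF psdD]]
  have "err_vec X m M d dt = dt + ?F (inv D (d - dt))"
    by (simp add: err_vec_def invD)
  hence "inv ?F (err_vec X m M d dt) = inv ?F dt + inv D (d - dt)"
    using bij_inv_simps(2)[OF bij_D_plus_U(1)] linear_add[OF bij_D_plus_U(2)] by simp
  hence split: "?R (inv ?F (err_vec X m M d dt)) = (?R \<circ> inv ?F) dt + inv ?R (d - dt)"
    by (simp add: linear_add[OF linR] psd_sqrt_inv[OF D_pos])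
  \<comment> \<open>The first blocks of \<open>d\<close> and \<open>dt\<close> cancel, so at most m
    - 1 blocks remain, each of norm at most 2 e.\<close>
  have "norm (d - dt) \<le> sqrt (real (card {2..m})) * (2 * e)"
  proof (rule norm_blocks_le[OF X])
    fix i assume "i \<in> {2..m}"
    hence i: "i \<in> {1..m}" by auto
    show "norm (blk X i (d - dt)) \<le> 2 * e"
      using norm_triangle_ineq4[of "blk X i d" "blk X i dt"] d[OF i] dt[OF i]
      by (simp add: linear_diff[OF linear_blk[OF X i]])
  next
    fix i assume "i \<in> {1..m} - {2..m}"
    hence "i = 1" "1 \<in> {1..m}" by auto
    thus "blk X i (d - dt) = 0" using 1 by (simp add: linear_diff[OF linear_blk[OF X]])
  qed (use e in auto)
  moreover have "norm dt \<le> sqrt (real (card {1..m})) * e"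
    by (rule norm_blocks_le[OF X]) (use e dt in auto)
  ultimately have le: "norm (d - dt) \<le> sqrt (real (m - 1)) * (2 * e)" "norm dt \<le> sqrt (real m) * e"
    by auto
  have blR: "bounded_linear (inv ?R)"
    using pos_def_sqrt_bij(2)[OF D_pos] by (simp add: linear_conv_bounded_linear)
  have blRF: "bounded_linear (?R \<circ> inv ?F)"
    using linear_compose[OF bij_D_plus_U(2) linR] by (simp add: linear_conv_bounded_linear)
  have "norm (?R (inv ?F (err_vec X m M d dt))) \<le> norm ((?R \<circ> inv ?F) dt) + norm (inv ?R (d - dt))"
    unfolding split by (rule norm_triangle_ineq)
  also have "\<dots> \<le> onorm (?R \<circ> inv ?F) * norm dt + onorm (inv ?R) * norm (d - dt)"
    by (intro add_mono onorm blR blRF)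
  also have "\<dots> \<le> onorm (?R \<circ> inv ?F) * (sqrt (real m) * e) + onorm (inv ?R) * (sqrt (real (m - 1)) * (2 * e))"
    by (intro add_mono mult_left_mono le onorm_pos_le blR blRF)
  also have "\<dots> = err_const X m M * e"
    by (simp add: err_const_def algebra_simps)
  finally show ?thesis by (simp add: norm_inv_sqrt_M_sGS)
qed

end

subsection \<open>Subgradients and minimizers of quadratic perturbations\<close>

lemma subdiff_cong:
  assumes "\<And>t. t \<in> V \<Longrightarrow> h t = h' t" "v \<in> V"
  shows "subdiff V h v = subdiff V h' v"
  using assms by (auto simp: subdiff_def)

text \<open>Since V is a subspace, v + g may be tested, which forces |g|^2 \<le> 0. For blocks other
  than the first this turns an inclusion into an equation.\<close>

lemma subdiff_const:
  assumes "subspace V" "v \<in> V" "\<bar>r\<bar> \<noteq> \<infinity>"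
  shows "subdiff V (\<lambda>t. r) v = {0}"
proof -
  obtain a where r: "r = ereal a" using assms(3) by auto
  have "g = 0" if g: "g \<in> subdiff V (\<lambda>t. r) v" for g
  proof -
    have "v + g \<in> V" using g assms by (auto simp: subdiff_def subspace_add)
    hence "r + ereal (g \<bullet> (v + g - v)) \<le> r" using g unfolding subdiff_def by blast
    thus ?thesis by (simp add: r) (metis inner_gt_zero_iff not_le)
  qed
  moreover have "0 \<in> subdiff V (\<lambda>t. r) v" using assms by (auto simp: subdiff_def subspace_0)
  ultimately show ?thesis by auto
qed

lemma subdiff_finite:
  assumes "g \<in> subdiff V h v" "u \<in> V" "h u < \<infinity>"
  shows "h v < \<infinity>"
  using assms by (auto simp: subdiff_def dest!: bspec[of _ _ u])

text \<open>The easy half of the sum rule. The exact expansion at \<open>v\<close> exhibits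
  \<open>G\<close> as the gradient of \<open>q\<close> along \<open>V\<close>, and a nonnegative
  second-order term gives the gradient inequality.\<close>

lemma subdiff_add_quadratic:
  assumes V: "subspace V" and G: "G \<in> V" and K: "\<And>w. w \<in> V \<Longrightarrow> 0 \<le> sqn K w" and v: "v \<in> V"
    and q: "\<And>t. t \<in> V \<Longrightarrow> q t = q v + G \<bullet> (t - v) + 1/2 * sqn K (t - v)"
    and xi: "\<xi> \<in> subdiff V \<psi> v"
  shows "\<xi> + G \<in> subdiff V (\<lambda>t. \<psi> t + ereal (q t)) v"
  unfolding subdiff_def
proof (intro CollectI conjI ballI)
  show "\<xi> + G \<in> V" using xi V G by (auto simp: subdiff_def subspace_add)
  fix t assume t: "t \<in> V"
  have "0 \<le> sqn K (t - v)" using K V t v by (simp add: subspace_diff)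
  hence "q v + G \<bullet> (t - v) \<le> q t" using q[OF t] by simp
  moreover have "\<psi> v + ereal (\<xi> \<bullet> (t - v)) \<le> \<psi> t" using xi t by (auto simp: subdiff_def)
  ultimately show "\<psi> v + ereal (q v) + ereal ((\<xi> + G) \<bullet> (t - v)) \<le> \<psi> t + ereal (q t)"
    by (cases "\<psi> v"; cases "\<psi> t") (auto simp: inner_add_left)
qed

text \<open>The other half of the sum rule. Apply the subgradient inequality at points of the
  segment from v to t, bound \<open>\<psi>\<close> there by convexity, divide by the step s and let
  s tend to 0; the quadratic term of \<open>q\<close> disappears.\<close>

lemma subdiff_remove_quadratic:
  assumes V: "subspace V" and G: "G \<in> V" and K: "linear K" and v: "v \<in> V"
    and q: "\<And>t. t \<in> V \<Longrightarrow> q t = q v + G \<bullet> (t - v) + 1/2 * sqn K (t - v)"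
    and conv: "convex (epigraph_on V \<psi>)"
    and g: "g \<in> subdiff V (\<lambda>t. \<psi> t + ereal (q t)) v"
  shows "g - G \<in> subdiff V \<psi> v"
  unfolding subdiff_def
proof (intro CollectI conjI ballI)
  show "g - G \<in> V" using g V G by (auto simp: subdiff_def subspace_diff)
  have ge: "\<psi> v + ereal (q v) + ereal (g \<bullet> (t - v)) \<le> \<psi> t + ereal (q t)" if "t \<in> V" for t
    using g that by (auto simp: subdiff_def)
  fix t assume t: "t \<in> V"
  show "\<psi> v + ereal ((g - G) \<bullet> (t - v)) \<le> \<psi> t"
  proof (cases "\<bar>\<psi> v\<bar> = \<infinity> \<or> \<bar>\<psi> t\<bar> = \<infinity>")
    case True
    thus ?thesis using ge[OF t] by (cases "\<psi> v"; cases "\<psi> t") auto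
  next
    case False
    then obtain a b where ab: "\<psi> v = ereal a" "\<psi> t = ereal b" by auto
    have "(g - G) \<bullet> (t - v) - (b - a) \<le> s * (1/2 * sqn K (t - v))" if s: "0 < s" "s \<le> 1" for s
    proof -
      define u where "u = (1 - s) *\<^sub>R v + s *\<^sub>R t"
      define r where "r = (1 - s) * a + s * b"
      have "(1 - s) *\<^sub>R (v, a) + s *\<^sub>R (t, b) \<in> epigraph_on V \<psi>"
        using convexD[OF conv, of "(v, a)" "(t, b)" "1 - s" s] ab t v s
        by (auto simp: epigraph_on_def)
      hence u: "u \<in> V" "\<psi> u \<le> ereal r" by (auto simp: epigraph_on_def u_def r_def)
      have uv: "u - v = s *\<^sub>R (t - v)" by (simp add: u_def algebra_simps)
      have "sqn K (u - v) = s * s * sqn K (t - v)"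
        by (simp add: uv sqn_def linear_scale[OF K])
      hence qu: "q u = q v + s * (G \<bullet> (t - v)) + 1/2 * (s * s * sqn K (t - v))"
        using q[OF u(1)] by (simp add: uv)
      have "ereal (a + q v + g \<bullet> (u - v)) \<le> \<psi> u + ereal (q u)" using ge[OF u(1)] ab by simp
      also have "\<dots> \<le> ereal (r + q u)" using u(2) by (cases "\<psi> u") auto
      finally have "a + q v + s * (g \<bullet> (t - v)) \<le> r + q u" by (simp add: uv)
      hence "s * ((g - G) \<bullet> (t - v) - (b - a)) \<le> s * (s * (1/2 * sqn K (t - v)))"
        by (simp add: qu r_def inner_diff_left algebra_simps)
      thus ?thesis using s by simp
    qed
    hence "(g - G) \<bullet> (t - v) - (b - a) \<le> 0" by (rule nonpos_if_le_small_multiples)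
    thus ?thesis by (simp add: ab)
  qed
qed

section \<open>Coercivity and existence of minimizers\<close>

lemma coercive_on_subspace:
  fixes K :: "'a::euclidean_space \<Rightarrow> 'a"
  assumes V: "subspace V" and K: "linear K" and pos: "\<And>u. u \<in> V \<Longrightarrow> u \<noteq> 0 \<Longrightarrow> 0 < sqn K u"
  shows "\<exists>c>0. \<forall>u\<in>V. c * (norm u)\<^sup>2 \<le> sqn K u"
proof (cases "V \<inter> sphere 0 1 = {}")
  case True
  have V0: "u = 0" if "u \<in> V" for u
  proof (rule ccontr)
    assume "u \<noteq> 0"
    hence "u /\<^sub>R norm u \<in> V \<inter> sphere 0 1" using that V by (simp add: subspace_scale)
    thus False using True by blast
  qed
  have "1 * (norm u)\<^sup>2 \<le> sqn K u" if "u \<in> V" for u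
    using linear_0[OF K] V0[OF that] by (simp add: sqn_def)
  thus ?thesis by (intro exI[of _ 1]) auto
next
  case False
  have "compact (V \<inter> sphere 0 1)" using closed_subspace[OF V] by (intro closed_Int_compact) auto
  moreover have "continuous_on (V \<inter> sphere 0 1) (\<lambda>u. sqn K u)"
    unfolding sqn_def
    by (intro continuous_intros linear_continuous_on) (use K in \<open>simp add: linear_linear\<close>)
  ultimately obtain w where w: "w \<in> V \<inter> sphere 0 1"
    and min: "\<forall>u\<in>V \<inter> sphere 0 1. sqn K w \<le> sqn K u"
    using continuous_attains_inf False by blast
  have "sqn K w * (norm u)\<^sup>2 \<le> sqn K u" if "u \<in> V" for u
  proof (cases "u = 0")
    case False
    have "u /\<^sub>R norm u \<in> V \<inter> sphere 0 1" using that False V by (simp add: subspace_scale)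
    hence "sqn K w \<le> sqn K (u /\<^sub>R norm u)" using min by blast
    also have "\<dots> = sqn K u / (norm u)\<^sup>2"
      by (simp add: sqn_def linear_scale[OF K] power2_eq_square divide_simps)
    finally show ?thesis using False by (simp add: divide_simps)
  qed (simp add: sqn_def)
  moreover have "0 < sqn K w" using w pos[of w] by (cases "w = 0") auto
  ultimately show ?thesis by blast
qed

text \<open>The Weierstrass theorem is applied on the epigraph: closedness there replaces lower
  semicontinuity, and the objective \<open>F\<close> at (t, r) is continuous. Boundedness of a
  sublevel set comes from an affine minorant of \<open>\<psi>\<close> together with coercivity of
  \<open>K\<close>.\<close>

lemma quadratic_perturbation_minimizer:
  fixes K :: "'a::euclidean_space \<Rightarrow> 'a"
  assumes V: "subspace V" and \<psi>: "closed_proper_convex_on V \<psi>"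
    and K: "linear K" and pos: "\<And>u. u \<in> V \<Longrightarrow> u \<noteq> 0 \<Longrightarrow> 0 < sqn K u"
    and q: "\<And>t. t \<in> V \<Longrightarrow> q t = q 0 + G \<bullet> t + 1/2 * sqn K t"
  shows "\<exists>v\<in>V. 0 \<in> subdiff V (\<lambda>t. \<psi> t + ereal (q t)) v"
proof -
  define E where "E = epigraph_on V \<psi>"
  have E: "convex E" "closed E" using \<psi> by (auto simp: closed_proper_convex_on_def E_def)
  obtain t0 where t0: "t0 \<in> V" "\<psi> t0 \<noteq> \<infinity>" "\<psi> t0 \<noteq> -\<infinity>"
    using \<psi> unfolding closed_proper_convex_on_def by blast
  then obtain r0 where r0: "\<psi> t0 = ereal r0" by (cases "\<psi> t0") auto
  have e0: "(t0, r0) \<in> E" "(t0, r0 - 1) \<notin> E" using t0 r0 by (auto simp: E_def epigraph_on_def)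
  \<comment> \<open>A point one unit below the graph is separated from the epigraph. Both (t0, r0)
    and (t0, r0 - 1) enter the inequalities, so the hyperplane is not vertical and s is
    positive.\<close>
  obtain a s b where sep: "a \<bullet> t0 + s * (r0 - 1) < b" "\<And>t r. (t, r) \<in> E \<Longrightarrow> b < a \<bullet> t + s * r"
    using separating_hyperplane_closed_point[OF E e0(2)] by (force simp: inner_Pair)
  have s: "0 < s" using sep(1) sep(2)[OF e0(1)] by (simp add: algebra_simps)
  have minor: "b / s - (a \<bullet> t) / s \<le> r" if "(t, r) \<in> E" for t r
    using sep(2)[OF that] s by (simp add: field_simps)
  obtain c where c: "0 < c" "\<And>u. u \<in> V \<Longrightarrow> c * (norm u)\<^sup>2 \<le> sqn K u"
    using coercive_on_subspace[OF V K pos] by blast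
  define F where "F = (\<lambda>(t, r). r + (q 0 + G \<bullet> t + 1/2 * sqn K t))"
  define C where "C = {e \<in> E. F e \<le> F (t0, r0)}"
  have contF: "continuous_on UNIV F"
    unfolding F_def case_prod_beta sqn_def
    by (intro continuous_intros linear_continuous_on continuous_on_compose2[OF linear_continuous_on, of K])
      (use K in \<open>auto simp: linear_linear\<close>)
  have "closed C"
  proof -
    have "C = E \<inter> {e. F e \<le> F (t0, r0)}" by (auto simp: C_def)
    thus ?thesis using E(2) contF by (simp add: closed_Int closed_Collect_le)
  qed
  moreover have "bounded C"
  proof -
    \<comment> \<open>The minorant and F(t, r) \<le> F(t0, r0) give (c/2) |t|^2 \<le> -<w,t> + k. If
      |t| > 1, then k \<le> k |t|, and division by |t| leaves |t| \<le> 2 (|w| + k)/c.\<close>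
    define w where "w = G - a /\<^sub>R s"
    define k where "k = \<bar>F (t0, r0) - q 0 - b / s\<bar>"
    define \<rho> where "\<rho> = max 1 (2 * (norm w + k) / c)"
    have "norm t \<le> \<rho> \<and> \<bar>r\<bar> \<le> \<bar>b / s\<bar> + norm a / s * \<rho> + \<bar>F (t0, r0) - q 0\<bar> + norm G * \<rho>"
      if tr: "(t, r) \<in> C" for t r
    proof -
      have m: "b / s - (a \<bullet> t) / s \<le> r" and tV: "t \<in> V" and
        F: "r + (q 0 + G \<bullet> t + 1/2 * sqn K t) \<le> F (t0, r0)"
        using tr minor by (auto simp: C_def E_def epigraph_on_def F_def)
      have "w \<bullet> t = G \<bullet> t - (a \<bullet> t) / s" by (simp add: w_def inner_diff_left divide_inverse)
      hence "c / 2 * (norm t)\<^sup>2 \<le> - (w \<bullet> t) + k" using m F c(2)[OF tV] unfolding k_def by linarith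
      also have "\<dots> \<le> norm w * norm t + k" using norm_cauchy_schwarz[of "-w" t] by simp
      finally have le: "c / 2 * (norm t)\<^sup>2 \<le> norm w * norm t + k" .
      have nt: "norm t \<le> \<rho>"
      proof (cases "norm t \<le> 1")
        case False
        have "0 \<le> k" by (simp add: k_def)
        hence "k \<le> k * norm t" using False mult_left_mono[of 1 "norm t" k] by simp
        hence "norm t * (c / 2 * norm t) \<le> norm t * (norm w + k)"
          using le by (simp add: power2_eq_square algebra_simps)
        hence "c / 2 * norm t \<le> norm w + k" by (rule mult_left_le_imp_le) (use False in linarith)
        hence "norm t \<le> 2 * (norm w + k) / c" using c(1) by (simp add: field_simps)
        thus ?thesis by (simp add: \<rho>_def)
      qed (simp add: \<rho>_def)
      have at: "\<bar>a \<bullet> t\<bar> \<le> norm a * \<rho>" and Gt: "\<bar>G \<bullet> t\<bar> \<le> norm G * \<rho>"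
        using Cauchy_Schwarz_ineq2[of a t] Cauchy_Schwarz_ineq2[of G t] nt
        by (smt (verit) mult_left_mono norm_ge_zero)+
      have "\<bar>(a \<bullet> t) / s\<bar> \<le> norm a / s * \<rho>"
        using at s by (simp add: abs_divide divide_right_mono)
      moreover have "0 \<le> sqn K t" using c(2)[OF tV] c(1) by (smt (verit) mult_nonneg_nonneg zero_le_power2)
      ultimately show ?thesis using nt m F Gt by linarith
    qed
    hence "C \<subseteq> cball 0 \<rho> \<times> cball 0 (\<bar>b / s\<bar> + norm a / s * \<rho> + \<bar>F (t0, r0) - q 0\<bar> + norm G * \<rho>)"
      by auto
    thus ?thesis using bounded_Times bounded_cball bounded_subset by metis
  qed
  ultimately have "compact C" by (simp add: compact_eq_bounded_closed)
  moreover have "(t0, r0) \<in> C" using e0 by (simp add: C_def)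
  ultimately obtain e where e: "e \<in> C" "\<And>e'. e' \<in> C \<Longrightarrow> F e \<le> F e'"
    using continuous_attains_inf[of C F] continuous_on_subset[OF contF] by blast
  obtain v r where vr: "e = (v, r)" by (cases e)
  have v: "v \<in> V" "\<psi> v \<le> ereal r" using e(1) by (auto simp: vr C_def E_def epigraph_on_def)
  \<comment> \<open>Points of the epigraph outside \<open>C\<close> have a value above F(t0, r0), so
    the minimum over \<open>C\<close> is global.\<close>
  have min: "F e \<le> F e'" if "e' \<in> E" for e'
    using e that by (cases "F e' \<le> F (t0, r0)") (auto simp: C_def intro: order_trans)
  have "\<psi> v + ereal (q v) + ereal (0 \<bullet> (t - v)) \<le> \<psi> t + ereal (q t)" if t: "t \<in> V" for t
  proof (cases "\<psi> t")
    case (real r')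
    have "(t, r') \<in> E" using real t by (simp add: E_def epigraph_on_def)
    from min[OF this] have "r + q v \<le> r' + q t"
      using q[OF t] q[OF v(1)] by (simp add: F_def vr)
    hence "ereal r + ereal (q v) \<le> ereal r' + ereal (q t)" by simp
    moreover have "\<psi> v + ereal (q v) \<le> ereal r + ereal (q v)" using v(2) by (rule add_right_mono)
    ultimately show ?thesis using real by (simp add: order_trans)
  next
    case MInf
    thus ?thesis using \<psi> t by (simp add: closed_proper_convex_on_def)
  qed simp
  thus ?thesis using v(1) V by (auto simp: subdiff_def subspace_0)
qed

lemma closed_proper_convex_on_const:
  assumes V: "subspace V" and r: "\<bar>r\<bar> \<noteq> \<infinity>"
  shows "closed_proper_convex_on V (\<lambda>t. r)"
proof -
  obtain a where a: "r = ereal a" using r by auto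
  have "epigraph_on V (\<lambda>t. r) = V \<times> {a..}" by (auto simp: epigraph_on_def a)
  thus ?thesis
    unfolding closed_proper_convex_on_def
    using V subspace_0[OF V] closed_subspace[OF V] subspace_imp_convex[OF V]
    by (auto simp: a closed_Times convex_Times)
qed

subsection \<open>Symmetric block sweeps\<close>

lemma psd_on_sqn_add:
  assumes "psd_on V H" "a \<in> V" "b \<in> V"
  shows "sqn H (a + b) = sqn H a + 2 * (H a \<bullet> b) + sqn H b"
  using psd_onD(3)[OF assms]
  by (simp add: sqn_def linear_add[OF psd_onD(1)[OF assms(1)]] inner_add_left inner_add_right
      inner_commute[of b])

text \<open>A sweep for a function that is \<open>p1\<close> of the first block plus an exact
  quadratic with Hessian \<open>Q\<close>. Both half steps have this shape once the other variable
  is frozen.\<close>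

locale block_sweep =
  fixes X :: "nat \<Rightarrow> 'a::euclidean_space set" and m :: nat
    and p1 :: "'a \<Rightarrow> ereal" and \<phi> :: "'a \<Rightarrow> real" and grad Q :: "'a \<Rightarrow> 'a"
    and S :: "nat \<Rightarrow> 'a \<Rightarrow> 'a"
  assumes blocks: "orthogonal_blocks X m" and m: "1 \<le> m"
    and p1: "closed_proper_convex_on (X 1) p1"
    and Q: "psd Q" and S: "\<forall>i\<in>{1..m}. psd_on (X i) (S i)"
    and expand: "\<And>u v. \<phi> v = \<phi> u + grad u \<bullet> (v - u) + 1/2 * sqn Q (v - u)"
    and grad: "\<And>u v. grad v = grad u + Q (v - u)"
    and D_pos': "pos_def (diag_part X m (\<lambda>u. Q u + Diag X m S u))"
begin

abbreviation "M \<equiv> \<lambda>u. Q u + Diag X m S u"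
abbreviation "h \<equiv> \<lambda>u. p1 (blk X 1 u) + ereal (\<phi> u)"

sublocale block_operator X m M
  by unfold_locales (intro blocks psd_add Q psd_Diag S D_pos')+

lemma one: "1 \<in> {1..m}" using m by simp

lemma subspace_X: "i \<in> {1..m} \<Longrightarrow> subspace (X i)"
  using blocks by (auto simp: orthogonal_blocks_def)

lemma linQ: "linear Q" using Q by (rule psd_onD)

lemma blk_around:
  assumes i: "i \<in> {1..m}" and l: "l \<in> {1..m}"
  shows "blk X l (around X m i u v) = (if l < i then blk X l u else if l = i then 0 else blk X l v)"
proof -
  have sum: "blk X l (\<Sum>j\<in>J. blk X j w) = (if l \<in> J then blk X l w else 0)" if "J \<subseteq> {1..m}" for J w
  proof -
    have "blk X l (\<Sum>j\<in>J. blk X j w) = (\<Sum>j\<in>J. if l = j then blk X l w else 0)"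
      unfolding linear_sum[OF linear_blk[OF blocks l]]
      using that by (intro sum.cong refl) (auto simp: blk_blk[OF blocks l])
    thus ?thesis using finite_subset[OF that] by (simp add: sum.delta)
  qed
  have "blk X l (around X m i u v) = blk X l (\<Sum>j\<in>{1..<i}. blk X j u) + blk X l (\<Sum>j\<in>{i<..m}. blk X j v)"
    unfolding around_def by (rule linear_add[OF linear_blk[OF blocks l]])
  also have "blk X l (\<Sum>j\<in>{1..<i}. blk X j u) = (if l \<in> {1..<i} then blk X l u else 0)"
    by (rule sum) (use i in auto)
  also have "blk X l (\<Sum>j\<in>{i<..m}. blk X j v) = (if l \<in> {i<..m} then blk X l v else 0)"
    by (rule sum) auto
  finally show ?thesis using l by auto
qed

text \<open>The nonsmooth term as seen by block \<open>i\<close>: a genuine function for the first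
  block and a constant for all others. This treats both cases with the same lemmas.\<close>

definition nonsmooth :: "nat \<Rightarrow> 'a \<Rightarrow> 'a \<Rightarrow> ereal" where
  "nonsmooth i b = (\<lambda>t. if i = 1 then p1 t else p1 (blk X 1 b))"

lemma h_block:
  assumes i: "i \<in> {1..m}" and b: "blk X i b = 0" and t: "t \<in> X i"
  shows "h (b + t) = nonsmooth i b t + ereal (\<phi> (b + t))"
  using blk_same[OF blocks i t] blk_zero_outside[OF blocks one i _ t] b
  by (auto simp: nonsmooth_def linear_add[OF linear_blk[OF blocks one]] simp del: One_nat_def)

lemma \<phi>_block:
  assumes i: "i \<in> {1..m}" and t: "t \<in> X i" and v: "v \<in> X i"
  shows "\<phi> (b + t) = \<phi> (b + v) + blk X i (grad (b + v)) \<bullet> (t - v) + 1/2 * sqn Q (t - v)"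
  using expand[of "b + t" "b + v"] inner_blk_left[OF blocks i, of "t - v" "grad (b + v)"]
    subspace_diff[OF subspace_X[OF i] t v] by simp

lemma nonsmooth_closed_proper_convex:
  assumes i: "i \<in> {1..m}" and fin: "i \<noteq> 1 \<Longrightarrow> \<bar>p1 (blk X 1 b)\<bar> \<noteq> \<infinity>"
  shows "closed_proper_convex_on (X i) (nonsmooth i b)"
proof (cases "i = 1")
  case True
  thus ?thesis using p1 by (simp add: nonsmooth_def)
next
  case False
  thus ?thesis
    unfolding nonsmooth_def using closed_proper_convex_on_const[OF subspace_X[OF i] fin] by simp
qed

lemma subdiff_block:
  assumes i: "i \<in> {1..m}" and b: "blk X i b = 0" and v: "v \<in> X i"
    and fin: "i \<noteq> 1 \<Longrightarrow> \<bar>p1 (blk X 1 b)\<bar> \<noteq> \<infinity>"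
    and g: "g \<in> subdiff (X i) (\<lambda>t. h (b + t)) v"
  shows "g - blk X i (grad (b + v)) \<in> subdiff (X i) (nonsmooth i b) v"
proof (rule subdiff_remove_quadratic[OF subspace_X[OF i] blk_in[OF blocks i] linQ v])
  show "g \<in> subdiff (X i) (\<lambda>t. nonsmooth i b t + ereal (\<phi> (b + t))) v"
    using g subdiff_cong[of "X i" "\<lambda>t. h (b + t)" "\<lambda>t. nonsmooth i b t + ereal (\<phi> (b + t))" v]
      h_block[OF i b] v by simp
  show "convex (epigraph_on (X i) (nonsmooth i b))"
    using nonsmooth_closed_proper_convex[OF i fin] by (simp add: closed_proper_convex_on_def)
qed (rule \<phi>_block[OF i _ v])

text \<open>The exact minimizer of the block problem qualifies, with error vector 0.\<close>

lemma block_step_exists: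
  assumes i: "i \<in> {1..m}" and b: "blk X i b = 0" and t0: "t0 \<in> X i"
    and fin: "i \<noteq> 1 \<Longrightarrow> \<bar>p1 (blk X 1 b)\<bar> \<noteq> \<infinity>" and \<epsilon>: "0 \<le> \<epsilon>"
  shows "\<exists>v e. block_step (X i) h (S i) \<epsilon> b t0 v e"
proof -
  let ?V = "X i" and ?\<psi> = "nonsmooth i b"
  let ?K = "\<lambda>u. Q u + S i u"
  note sub = subspace_X[OF i]
  have Si: "psd_on ?V (S i)" using S i by blast
  note linS = psd_onD(1)[OF Si]
  have linK: "linear ?K" using linQ linS by (rule linear_compose_add)
  have sqn_S: "sqn (S i) (t - t0) = sqn (S i) (v - t0) + 2 * (S i (v - t0) \<bullet> (t - v)) + sqn (S i) (t - v)"
    if "t \<in> ?V" "v \<in> ?V" for t v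
    using psd_on_sqn_add[OF Si, of "v - t0" "t - v"] that t0 sub by (simp add: subspace_diff)
  define q where "q t = \<phi> (b + t) + 1/2 * sqn (S i) (t - t0)" for t
  have q: "q t = q v + (blk X i (grad (b + v)) + S i (v - t0)) \<bullet> (t - v) + 1/2 * sqn ?K (t - v)"
    if "t \<in> ?V" "v \<in> ?V" for t v
    using \<phi>_block[OF i that, of b] sqn_S[OF that]
    by (simp add: q_def sqn_def inner_add_left inner_add_right algebra_simps)
  have cpc: "closed_proper_convex_on ?V ?\<psi>" using i fin by (rule nonsmooth_closed_proper_convex)
  have pos: "0 < sqn ?K u" if "u \<in> ?V" "u \<noteq> 0" for u
  proof -
    have "u \<bullet> Diag X m S u = u \<bullet> blk X i (Diag X m S u)"
      using inner_blk_left[OF blocks i that(1)] by (metis inner_commute)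
    also have "\<dots> = u \<bullet> S i u"
      using blk_Diag[OF blocks S i, of u] blk_same[OF blocks i that(1)] by simp
    finally show ?thesis using M_pos_block[OF i that] by (simp add: sqn_def inner_add_right)
  qed
  have q0: "q t = q 0 + (blk X i (grad (b + 0)) + S i (0 - t0)) \<bullet> t + 1/2 * sqn ?K t" if "t \<in> ?V" for t
    using q[OF that subspace_0[OF sub]] by simp
  obtain v where v: "v \<in> ?V" and min: "0 \<in> subdiff ?V (\<lambda>t. ?\<psi> t + ereal (q t)) v"
    using quadratic_perturbation_minimizer[OF sub cpc linK pos q0] by blast
  have SV: "S i (v - t0) \<in> ?V" using v t0 sub psd_onD(2)[OF Si] by (simp add: subspace_diff)
  \<comment> \<open>A block step asks for a subgradient of \<open>h\<close> alone. The whole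
    quadratic is therefore removed first, and its part \<open>\<phi>\<close> is then added back,
    leaving out the proximal term.\<close>
  have "0 - (blk X i (grad (b + v)) + S i (v - t0)) \<in> subdiff ?V ?\<psi> v"
    by (rule subdiff_remove_quadratic[OF sub _ linK v q[OF _ v] _ min])
      (use sub blk_in[OF blocks i] SV cpc in \<open>auto simp: subspace_add closed_proper_convex_on_def\<close>)
  hence "0 - (blk X i (grad (b + v)) + S i (v - t0)) + blk X i (grad (b + v))
      \<in> subdiff ?V (\<lambda>t. ?\<psi> t + ereal (\<phi> (b + t))) v"
    using psd_onD(4)[OF Q] by (intro subdiff_add_quadratic[OF sub blk_in[OF blocks i] _ v \<phi>_block[OF i _ v]])
      (auto simp: sqn_def)
  hence "- S i (v - t0) \<in> subdiff ?V (\<lambda>t. h (b + t)) v"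
    using subdiff_cong[of ?V "\<lambda>t. h (b + t)" "\<lambda>t. ?\<psi> t + ereal (\<phi> (b + t))" v] h_block[OF i b] v
    by simp
  hence "block_step ?V h (S i) \<epsilon> b t0 v 0"
    unfolding block_step_def using v \<epsilon> by (auto intro!: exI[of _ "- S i (v - t0)"])
  thus ?thesis by blast
qed

text \<open>At block i, U^* sees only earlier blocks and U only later ones. The mixed point can thus
  be replaced by the full vectors \<open>u\<close>, \<open>w\<close> and \<open>v\<close>, so the
  block conditions become rows of one triangular system.\<close>

lemma blk_gradient:
  assumes i: "i \<in> {1..m}"
  shows "blk X i (grad (around X m i u v + blk X i w)) + S i (blk X i w - blk X i x)
    = blk X i (grad x + Us (u - x) + D (w - x) + U (v - x))"
proof -
  define y where "y = around X m i u v + blk X i w - x"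
  have blk_y: "blk X l y = blk X l (if l < i then u - x else if l = i then w - x else v - x)"
    if l: "l \<in> {1..m}" for l
    using blk_around[OF i l] blk_blk[OF blocks l i]
    by (auto simp: y_def linear_add[OF linear_blk[OF blocks l]] linear_diff[OF linear_blk[OF blocks l]]
        linear_diff[OF linear_blk[OF blocks i]])
  have "blk X i (Us y) = blk X i (Us (u - x))"
    unfolding blk_Us[OF i] using i by (intro sum.cong refl) (simp add: blk_y)
  moreover have "blk X i (U y) = blk X i (U (v - x))"
    unfolding blk_U[OF i] using i by (intro sum.cong refl) (simp add: blk_y)
  moreover have "blk X i (D y) = blk X i (D (w - x))"
    unfolding blk_D[OF i] using i by (simp add: blk_y)
  ultimately have My: "blk X i (M y) = blk X i (Us (u - x) + D (w - x) + U (v - x))"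
    unfolding M_split[of y] by (simp add: linear_add[OF linear_blk[OF blocks i]] algebra_simps)
  have "S i (blk X i w - blk X i x) = S i (blk X i y)"
    using blk_y[OF i] by (simp add: linear_diff[OF linear_blk[OF blocks i]])
  also have "\<dots> = blk X i (Diag X m S y)" by (rule blk_Diag[OF blocks S i, symmetric])
  finally have "blk X i (grad (around X m i u v + blk X i w)) + S i (blk X i w - blk X i x)
      = blk X i (grad x) + blk X i (M y)"
    by (simp add: y_def grad[of "around X m i u v + blk X i w" x] linear_add[OF linear_blk[OF blocks i]])
  thus ?thesis unfolding My by (simp add: linear_add[OF linear_blk[OF blocks i]] add.assoc)
qed

text \<open>The gradient of the quadratic part is moved to the side of the error. Backward steps use
  it with u = x, forward steps with the new iterate as u.\<close>

lemma block_step_residual: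
  assumes i: "i \<in> {1..m}" and fin: "i \<noteq> 1 \<Longrightarrow> \<bar>p1 (blk X 1 u)\<bar> \<noteq> \<infinity>"
    and step: "block_step (X i) h (S i) \<epsilon> (around X m i u v) (blk X i x) (blk X i w) (blk X i e)"
  shows "blk X i (e - (grad x + Us (u - x) + D (w - x) + U (v - x)))
    \<in> subdiff (X i) (nonsmooth i u) (blk X i w)"
proof -
  let ?b = "around X m i u v"
  obtain g where g: "g \<in> subdiff (X i) (\<lambda>t. h (?b + t)) (blk X i w)"
    and e: "blk X i e = g + S i (blk X i w - blk X i x)"
    using step by (auto simp: block_step_def)
  have b: "blk X i ?b = 0" using blk_around[OF i i] by simp
  have b1: "blk X 1 ?b = blk X 1 u" if "i \<noteq> 1" using blk_around[OF i one] that i by simp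
  hence ns: "nonsmooth i ?b = nonsmooth i u" by (auto simp: nonsmooth_def)
  have "g - blk X i (grad (?b + blk X i w)) \<in> subdiff (X i) (nonsmooth i u) (blk X i w)"
    using subdiff_block[OF i b blk_in[OF blocks i] _ g] fin b1 by (simp add: ns)
  also have "g - blk X i (grad (?b + blk X i w))
      = blk X i (e - (grad x + Us (u - x) + D (w - x) + U (v - x)))"
    unfolding linear_diff[OF linear_blk[OF blocks i]] blk_gradient[OF i, symmetric] e by simp
  finally show ?thesis .
qed

lemma block_step_residual_zero:
  assumes i: "i \<in> {2..m}" and fin: "\<bar>p1 (blk X 1 u)\<bar> \<noteq> \<infinity>"
    and step: "block_step (X i) h (S i) \<epsilon> (around X m i u v) (blk X i x) (blk X i w) (blk X i e)"
  shows "blk X i (e - (grad x + Us (u - x) + D (w - x) + U (v - x))) = 0"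
proof -
  have i': "i \<in> {1..m}" "i \<noteq> 1" using i by auto
  have "subdiff (X i) (nonsmooth i u) (blk X i w) = {0}"
    using subdiff_const[OF subspace_X[OF i'(1)] blk_in[OF blocks i'(1)] fin] i'(2)
    by (simp add: nonsmooth_def)
  thus ?thesis using block_step_residual[OF i'(1) fin step] by simp
qed

lemma p1_not_MInf: "p1 (blk X 1 u) \<noteq> -\<infinity>"
  using p1 blk_in[OF blocks one] by (auto simp: closed_proper_convex_on_def)

text \<open>A subgradient at a point of value \<infinity> would force the function to be \<infinity>
  everywhere, against properness.\<close>

lemma forward_step_first_finite:
  assumes "forward_step X m h S \<epsilon> x ut u' 1 (blk X 1 u') (blk X 1 d)"
  shows "p1 (blk X 1 u') < \<infinity>"
proof -
  have "block_step (X 1) h (S 1) \<epsilon> (around X m 1 u' ut) (blk X 1 x) (blk X 1 u') (blk X 1 d)"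
    using assms by (simp add: forward_step_def)
  from block_step_residual[OF one _ this] obtain g where "g \<in> subdiff (X 1) p1 (blk X 1 u')"
    by (auto simp: nonsmooth_def)
  moreover obtain t where "t \<in> X 1" "p1 t < \<infinity>"
    using p1 by (auto simp: closed_proper_convex_on_def)
  ultimately show ?thesis by (rule subdiff_finite)
qed

lemma sweep_finite:
  assumes "sweep X m h S \<epsilon> x ut u' dt d"
  shows "p1 (blk X 1 u') < \<infinity>"
  using assms one unfolding sweep_def by (blast intro: forward_step_first_finite)

lemma sweep_executable:
  assumes fin: "p1 (blk X 1 x) < \<infinity>" and \<epsilon>: "0 \<le> \<epsilon>"
  shows "sweep_executable X m h S \<epsilon> x"
  unfolding sweep_executable_def
proof (intro conjI ballI allI impI)
  fix i ut dt assume "i \<in> {2..m}"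
  hence i: "i \<in> {1..m}" "i \<noteq> 1" by auto
  show "\<exists>v e. backward_step X m h S \<epsilon> x ut i v e"
    unfolding backward_step_def
    using blk_around[OF i(1) i(1)] blk_around[OF i(1) one] blk_in[OF blocks i(1)] fin p1_not_MInf i \<epsilon>
    by (intro block_step_exists) auto
next
  fix i ut dt u' d assume i: "i \<in> {1..m}"
    and prev: "(\<forall>l\<in>{2..m}. backward_step X m h S \<epsilon> x ut l (blk X l ut) (blk X l dt)) \<and>
        (\<forall>l\<in>{1..<i}. forward_step X m h S \<epsilon> x ut u' l (blk X l u') (blk X l d))"
  \<comment> \<open>Later forward steps freeze the new first block; its value is finite because
    forward step 1 has already been performed.\<close>
  have fin': "p1 (blk X 1 u') < \<infinity>" if "i \<noteq> 1"
    using prev i that by (intro forward_step_first_finite) auto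
  show "\<exists>v e. forward_step X m h S \<epsilon> x ut u' i v e"
    unfolding forward_step_def
    using blk_around[OF i i] blk_around[OF i one] blk_in[OF blocks i] fin' p1_not_MInf i \<epsilon>
    by (intro block_step_exists) auto
qed

text \<open>Multiplying the backward equations by \<open>U D\<^sup>-\<^sup>1\<close> eliminates the intermediate point \<open>ut\<close>. The first
  block, for which there is no backward equation, is annihilated by \<open>U\<close>.\<close>

lemma sweep_residual:
  assumes fin: "p1 (blk X 1 x) < \<infinity>" and sw: "sweep X m h S \<epsilon> x ut u' dt d"
  shows "\<exists>\<xi>. blk X 1 \<xi> \<in> subdiff (X 1) p1 (blk X 1 u') \<and> (\<forall>i\<in>{2..m}. blk X i \<xi> = 0) \<and>
    \<xi> = err_vec X m M d dt - (grad x + M (u' - x) + sGS X m M (u' - x))"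
proof -
  \<comment> \<open>The residuals of the forward and the backward system. The term in x - x is zero;
    it keeps \<open>\<rho>\<close> in the form delivered by
    \<open>block_step_residual_zero\<close>.\<close>
  define \<xi> where "\<xi> = d - (grad x + Us (u' - x) + D (u' - x) + U (ut - x))"
  define \<rho> where "\<rho> = dt - (grad x + Us (x - x) + D (ut - x) + U (ut - x))"
  have bw: "\<And>i. i \<in> {2..m} \<Longrightarrow>
      block_step (X i) h (S i) \<epsilon> (around X m i x ut) (blk X i x) (blk X i ut) (blk X i dt)"
    and fw: "\<And>i. i \<in> {1..m} \<Longrightarrow>
      block_step (X i) h (S i) \<epsilon> (around X m i u' ut) (blk X i x) (blk X i u') (blk X i d)"
    using sw by (auto simp: sweep_def backward_step_def forward_step_def)
  have x_fin: "\<bar>p1 (blk X 1 x)\<bar> \<noteq> \<infinity>" and u_fin: "\<bar>p1 (blk X 1 u')\<bar> \<noteq> \<infinity>"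
    using fin sweep_finite[OF sw] p1_not_MInf by auto
  have \<xi>1: "blk X 1 \<xi> \<in> subdiff (X 1) p1 (blk X 1 u')"
    using block_step_residual[OF one _ fw[OF one]] by (simp add: \<xi>_def nonsmooth_def)
  have \<xi>i: "blk X i \<xi> = 0" if "i \<in> {2..m}" for i
    unfolding \<xi>_def using that by (intro block_step_residual_zero[OF that u_fin fw]) auto
  have \<rho>i: "blk X i \<rho> = 0" if "i \<in> {2..m}" for i
    unfolding \<rho>_def using that by (intro block_step_residual_zero[OF that x_fin bw]) auto
  \<comment> \<open>Subtracting the two systems cancels U (ut - x). The vector \<open>a\<close>
    solves what is left for ut - x as if \<open>\<rho>\<close> and \<open>\<xi>\<close> agreed in
    every block; they do agree from the second block on.\<close>
  define a where "a = (u' - x) + inv D (Us (u' - x) - (d - dt))"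
  have "D a = D (u' - x) + (Us (u' - x) - (d - dt))" by (simp add: a_def linear_add[OF linD] invD)
  hence "D (a - (ut - x)) = \<rho> - \<xi>"
    unfolding linear_diff[OF linD, of a] by (simp add: linear_0[OF linUs] \<rho>_def \<xi>_def)
  hence "blk X i (a - (ut - x)) = 0" if "i \<in> {2..m}" for i
    using that \<rho>i \<xi>i blk_zero_if_D_zero[of i "a - (ut - x)"]
    by (auto simp: linear_diff[OF linear_blk[OF blocks]])
  hence "U (a - (ut - x)) = 0"
    unfolding upper_part_def using linear_0[OF linM] linear_0[OF linear_blk[OF blocks]]
    by (intro sum.neutral ballI) auto
  hence "U (ut - x) = U (u' - x) + U (inv D (Us (u' - x))) - U (inv D (d - dt))"
    by (simp add: a_def linear_diff[OF linU] linear_add[OF linU] linear_diff[OF invD(3)])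
      (simp add: algebra_simps)
  hence "\<xi> = err_vec X m M d dt - (grad x + M (u' - x) + sGS X m M (u' - x))"
    unfolding \<xi>_def err_vec_def sGS_apply M_split[of "u' - x"] by (simp add: algebra_simps)
  thus ?thesis using \<xi>1 \<xi>i by blast
qed

lemma sweep_subdiff:
  assumes fin: "p1 (blk X 1 x) < \<infinity>" and sw: "sweep X m h S \<epsilon> x ut u' dt d"
  shows "err_vec X m M d dt
    \<in> subdiff UNIV (\<lambda>u. h u + ereal (1/2 * sqn (\<lambda>u. Diag X m S u + sGS X m M u) (u - x))) u'"
proof -
  let ?S = "\<lambda>u. Diag X m S u + sGS X m M u"
  let ?K = "\<lambda>u. Q u + ?S u"
  obtain \<xi> where \<xi>1: "blk X 1 \<xi> \<in> subdiff (X 1) p1 (blk X 1 u')" and \<xi>i: "\<forall>i\<in>{2..m}. blk X i \<xi> = 0"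
    and \<xi>: "\<xi> = err_vec X m M d dt - (grad x + M (u' - x) + sGS X m M (u' - x))"
    using sweep_residual[OF assms] by blast
  \<comment> \<open>Only the first block of \<open>\<xi>\<close> is nonzero, so a subgradient on
    that factor is one on the whole space.\<close>
  have "\<xi> \<in> subdiff UNIV (\<lambda>u. p1 (blk X 1 u)) u'"
    unfolding subdiff_def
  proof (intro CollectI conjI ballI)
    fix v
    have "\<xi> \<bullet> (v - u') = (\<Sum>i\<in>{1..m}. blk X i \<xi> \<bullet> blk X i (v - u'))" by (rule inner_blk[OF blocks])
    also have "\<dots> = blk X 1 \<xi> \<bullet> blk X 1 (v - u')"
      using one \<xi>i by (subst sum.remove[of _ 1]) (auto intro!: sum.neutral)
    also have "\<dots> = blk X 1 \<xi> \<bullet> (blk X 1 v - blk X 1 u')"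
      by (simp only: linear_diff[OF linear_blk[OF blocks one]])
    finally show "p1 (blk X 1 u') + ereal (\<xi> \<bullet> (v - u')) \<le> p1 (blk X 1 v)"
      using \<xi>1 blk_in[OF blocks one] by (auto simp: subdiff_def)
  qed simp
  moreover have psdS: "psd ?S" using psd_Diag[OF blocks S] psd_sGS by (rule psd_add)
  have "\<phi> t + 1/2 * sqn ?S (t - x) = \<phi> u' + 1/2 * sqn ?S (u' - x)
      + (grad u' + ?S (u' - x)) \<bullet> (t - u') + 1/2 * sqn ?K (t - u')" for t
  proof -
    have "sqn ?S (t - x) = sqn ?S (u' - x) + 2 * (?S (u' - x) \<bullet> (t - u')) + sqn ?S (t - u')"
      using psd_on_sqn_add[OF psdS, of "u' - x" "t - u'"] by simp
    thus ?thesis using expand[of t u']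
      by (simp add: sqn_def inner_add_left inner_add_right algebra_simps)
  qed
  moreover have "0 \<le> sqn ?K w" for w
    using psd_onD(4)[OF psd_add[OF Q psdS]] by (simp add: sqn_def)
  ultimately have "\<xi> + (grad u' + ?S (u' - x))
      \<in> subdiff UNIV (\<lambda>t. p1 (blk X 1 t) + ereal (\<phi> t + 1/2 * sqn ?S (t - x))) u'"
    by - (rule subdiff_add_quadratic[where K = ?K and q = "\<lambda>t. \<phi> t + 1/2 * sqn ?S (t - x)",
      OF subspace_UNIV UNIV_I _ UNIV_I])
  \<comment> \<open>The gradient at the new point is \<open>grad x\<close> plus (M + sGS(M)) (u' -
    x), exactly what \<open>\<xi>\<close> subtracts from the error vector.\<close>
  also have "\<xi> + (grad u' + ?S (u' - x)) = err_vec X m M d dt"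
    by (simp add: \<xi> grad[of u' x])
  finally show ?thesis by (simp add: add.assoc)
qed

lemma sweep_norm_bound:
  assumes sw: "sweep X m h S \<epsilon> x ut u' dt d" and \<epsilon>: "0 \<le> \<epsilon>"
  shows "norm (inv (psd_sqrt (\<lambda>u. M u + sGS X m M u)) (err_vec X m M d dt)) \<le> err_const X m M * \<epsilon>"
proof (rule norm_err_vec_le[OF m \<epsilon>])
  show d: "norm (blk X i d) \<le> \<epsilon>" if "i \<in> {1..m}" for i
    using sw that by (auto simp: sweep_def forward_step_def block_step_def)
  show 1: "blk X 1 dt = blk X 1 d" using sw by (simp add: sweep_def)
  show "norm (blk X i dt) \<le> \<epsilon>" if "i \<in> {1..m}" for i
  \<comment> \<open>No backward step bounds the first block of \<open>dt\<close>; it is bounded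
    through its identification with the forward error.\<close>
  proof (cases "i = 1")
    case True
    thus ?thesis using 1 d[OF that] by simp
  next
    case False
    hence "i \<in> {2..m}" using that by auto
    thus ?thesis using sw by (auto simp: sweep_def backward_step_def block_step_def)
  qed
qed

end

subsection \<open>The two half steps of the algorithm\<close>

text \<open>Exchanging the two variables makes the y half step an instance of the x half
  step.\<close>

lemma aug_lagrangian_commute:
  "aug_lagrangian p F q G A B c \<sigma> z u v = aug_lagrangian q G p F B A c \<sigma> z v u"
proof -
  have "adjoint A u + adjoint B v - c = adjoint B v + adjoint A u - c" by simp
  thus ?thesis by (simp add: aug_lagrangian_def Let_def ac_simps)
qed

lemma aug_lagrangian_eq:
  assumes "\<bar>q v\<bar> \<noteq> \<infinity>"
  shows "aug_lagrangian p F q G A B c \<sigma> z u v = p u + ereal (F u + real_of_ereal (q v) + G v +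
    z \<bullet> (adjoint A u + adjoint B v - c) + \<sigma> / 2 * (norm (adjoint A u + adjoint B v - c))\<^sup>2)"
  using assms by (cases "q v"; cases "p u") (auto simp: aug_lagrangian_def Let_def)

text \<open>The diagonal proximal term inside \<open>S_hat\<close> is regrouped with
  \<open>\<Sigma>\<close> and the Gram term to form \<open>M_tilde\<close>.\<close>

lemma M_hat_eq:
  "M_hat X m \<Sigma> A \<sigma> S = (\<lambda>u. M_tilde X m \<Sigma> A \<sigma> S u + sGS X m (M_tilde X m \<Sigma> A \<sigma> S) u)"
  unfolding M_hat_def S_hat_def
  by (subst (2) M_tilde_def) (simp add: add.assoc)

text \<open>One variable moves and the other is frozen at \<open>v\<close>, a point of finite value;
  \<open>x\<close> is the centre of the majorant.\<close>

locale half_step =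
  fixes X :: "nat \<Rightarrow> 'x::euclidean_space set" and m :: nat
    and p1 :: "'x \<Rightarrow> ereal" and f :: "'x \<Rightarrow> real" and Df \<Sigma> :: "'x \<Rightarrow> 'x"
    and A :: "'z::euclidean_space \<Rightarrow> 'x" and B :: "'z \<Rightarrow> 'y::euclidean_space"
    and c z :: 'z and \<sigma> :: real and S :: "nat \<Rightarrow> 'x \<Rightarrow> 'x"
    and q :: "'y \<Rightarrow> ereal" and G :: "'y \<Rightarrow> real" and x :: 'x and v :: 'y
  assumes blocks: "orthogonal_blocks X m" and m: "1 \<le> m"
    and p1: "closed_proper_convex_on (X 1) p1"
    and \<Sigma>: "psd \<Sigma>" and S: "\<forall>i\<in>{1..m}. psd_on (X i) (S i)"
    and A: "linear A" and \<sigma>: "0 < \<sigma>"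
    and Mt_pos: "pos_def (diag_part X m (M_tilde X m \<Sigma> A \<sigma> S))"
    and q: "\<bar>q v\<bar> \<noteq> \<infinity>"
begin

abbreviation "Q \<equiv> \<lambda>u. \<Sigma> u + \<sigma> *\<^sub>R A (adjoint A u)"
abbreviation "res \<equiv> \<lambda>u. adjoint A u + adjoint B v - c"
abbreviation "L \<equiv> \<lambda>u. aug_lagrangian (\<lambda>u. p1 (blk X 1 u)) (\<lambda>u. majorant f Df \<Sigma> u x) q G A B c \<sigma> z u v"
abbreviation "Mt \<equiv> M_tilde X m \<Sigma> A \<sigma> S"

definition \<phi> where
  "\<phi> u = majorant f Df \<Sigma> u x + real_of_ereal (q v) + G v + z \<bullet> res u + \<sigma> / 2 * (norm (res u))\<^sup>2"

definition grad where "grad u = Df x + \<Sigma> (u - x) + A z + \<sigma> *\<^sub>R A (res u)"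

lemma Mt: "Mt = (\<lambda>u. Q u + Diag X m S u)"
  by (simp add: M_tilde_def)

lemma psdQ: "psd Q"
  using \<sigma> by (intro psd_add \<Sigma> psd_scaled_gram A) simp

lemma L: "L u = p1 (blk X 1 u) + ereal (\<phi> u)"
  unfolding \<phi>_def using q by (rule aug_lagrangian_eq)

text \<open>The majorant, multiplier and penalty terms are each expanded exactly about
  \<open>u\<close>, using that the constraint residual changes by A^* (w - u). Their second-order
  parts add up to \<open>Q\<close>.\<close>

sublocale block_sweep X m p1 \<phi> grad Q S
proof
  fix u w :: 'x
  note linA' = adjoint_linear[OF A]
  have res: "res w = res u + adjoint A (w - u)" by (simp add: linear_diff[OF linA'])
  have adj: "A a \<bullet> b = a \<bullet> adjoint A b" for a b using adjoint_works[OF A] by simp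
  have "Df x \<bullet> (w - x) = Df x \<bullet> (u - x) + Df x \<bullet> (w - u)"
    by (simp add: inner_diff_right)
  moreover have "sqn \<Sigma> (w - x) = sqn \<Sigma> (u - x) + 2 * (\<Sigma> (u - x) \<bullet> (w - u)) + sqn \<Sigma> (w - u)"
    using psd_on_sqn_add[OF \<Sigma>, of "u - x" "w - u"] by simp
  moreover have "(norm (res w))\<^sup>2 = (norm (res u))\<^sup>2 + 2 * (A (res u) \<bullet> (w - u))
      + (w - u) \<bullet> A (adjoint A (w - u))"
    unfolding res power2_norm_eq_inner inner_commute[of "w - u"] adj
    by (simp add: inner_add_left inner_add_right inner_commute)
  moreover have "z \<bullet> res w = z \<bullet> res u + A z \<bullet> (w - u)"
    unfolding res adj by (simp add: inner_add_right)
  moreover have "grad u \<bullet> (w - u) = Df x \<bullet> (w - u) + \<Sigma> (u - x) \<bullet> (w - u) + A z \<bullet> (w - u)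
      + \<sigma> * (A (res u) \<bullet> (w - u))"
    by (simp add: grad_def inner_add_left)
  moreover have "sqn Q (w - u) = sqn \<Sigma> (w - u) + \<sigma> * ((w - u) \<bullet> A (adjoint A (w - u)))"
    by (simp add: sqn_def inner_add_right)
  ultimately show "\<phi> w = \<phi> u + grad u \<bullet> (w - u) + 1/2 * sqn Q (w - u)"
    unfolding \<phi>_def majorant_def by (simp only: distrib_left)
  show "grad w = grad u + Q (w - u)"
    unfolding grad_def res
    by (simp add: linear_add[OF A] linear_diff[OF psd_onD(1)[OF \<Sigma>]] scaleR_add_right)
  show "pos_def (diag_part X m (\<lambda>u. Q u + Diag X m S u))" using Mt_pos by (simp add: Mt)
qed (use blocks m p1 S psdQ in auto)

lemma L_executable: "p1 (blk X 1 x) < \<infinity> \<Longrightarrow> 0 \<le> \<epsilon> \<Longrightarrow> sweep_executable X m L S \<epsilon> x"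
  unfolding L by (rule sweep_executable)

lemma L_finite: "sweep X m L S \<epsilon> x ut u' dt d \<Longrightarrow> p1 (blk X 1 u') < \<infinity>"
  unfolding L by (rule sweep_finite)

lemma L_subdiff:
  assumes "p1 (blk X 1 x) < \<infinity>" "sweep X m L S \<epsilon> x ut u' dt d"
  shows "err_vec X m Mt d dt
    \<in> subdiff UNIV (\<lambda>u. L u + ereal (1/2 * sqn (S_hat X m \<Sigma> A \<sigma> S) (u - x))) u'"
  using sweep_subdiff[of x] assms unfolding L S_hat_def Mt by blast

lemma L_norm_bound:
  assumes "sweep X m L S \<epsilon> x ut u' dt d" "0 \<le> \<epsilon>"
  shows "norm (inv (psd_sqrt (M_hat X m \<Sigma> A \<sigma> S)) (err_vec X m Mt d dt)) \<le> err_const X m Mt * \<epsilon>"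
  using sweep_norm_bound[of \<epsilon> x] assms unfolding L M_hat_eq Mt by blast

end

text \<open>Kept outside \<open>half_step\<close>, since positive definiteness should not depend on
  a frozen point of finite value.\<close>

lemma pos_def_M_hat:
  assumes X: "orthogonal_blocks X m" and "psd \<Sigma>" "linear A" "0 < \<sigma>"
    and S: "\<forall>i\<in>{1..m}. psd_on (X i) (S i)"
    and D: "pos_def (diag_part X m (M_tilde X m \<Sigma> A \<sigma> S))"
  shows "pos_def (M_hat X m \<Sigma> A \<sigma> S)"
proof -
  have "psd (M_tilde X m \<Sigma> A \<sigma> S)"
    unfolding M_tilde_def using assms by (intro psd_add psd_scaled_gram psd_Diag) auto
  then interpret block_operator X m "M_tilde X m \<Sigma> A \<sigma> S" using X D by unfold_locales
  show ?thesis using pos_def_M_sGS by (simp add: M_hat_eq)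
qed

text \<open>Well-definedness reads as follows: after any completed iterations the x sweep cannot get
  stuck, and once it is done neither can the y sweep. The multiplier update is an explicit
  formula.\<close>

theorem proposition4p2:
  fixes m n :: nat
    and X :: "nat \<Rightarrow> 'x::euclidean_space set" and Y :: "nat \<Rightarrow> 'y::euclidean_space set"
    and p1 :: "'x \<Rightarrow> ereal" and q1 :: "'y \<Rightarrow> ereal"
    and f :: "'x \<Rightarrow> real" and g :: "'y \<Rightarrow> real"
    and Df \<Sigma>f :: "'x \<Rightarrow> 'x" and Dg \<Sigma>g :: "'y \<Rightarrow> 'y"
    and Ai :: "nat \<Rightarrow> 'z::euclidean_space \<Rightarrow> 'x" and Bj :: "nat \<Rightarrow> 'z \<Rightarrow> 'y"
    and A :: "'z \<Rightarrow> 'x" and B :: "'z \<Rightarrow> 'y" and c :: 'z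
    and S :: "nat \<Rightarrow> 'x \<Rightarrow> 'x" and T :: "nat \<Rightarrow> 'y \<Rightarrow> 'y"
    and \<sigma> \<tau> :: real and \<epsilon> :: "nat \<Rightarrow> real"
    and x xt \<delta> \<delta>t :: "nat \<Rightarrow> 'x" and y yt \<gamma> \<gamma>t :: "nat \<Rightarrow> 'y" and z :: "nat \<Rightarrow> 'z"
    and p :: "'x \<Rightarrow> ereal" and q :: "'y \<Rightarrow> ereal"
    and L :: "nat \<Rightarrow> 'x \<Rightarrow> 'y \<Rightarrow> ereal"
    and Mt Mh Sh :: "'x \<Rightarrow> 'x" and Nt Nh Th :: "'y \<Rightarrow> 'y"
    and x_sweep y_sweep iteration :: "nat \<Rightarrow> bool"
    and dx :: "nat \<Rightarrow> 'x" and dy :: "nat \<Rightarrow> 'y"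
  assumes "m \<ge> 1" and "n \<ge> 1"
    and "orthogonal_blocks X m" and "orthogonal_blocks Y n"
    and "closed_proper_convex_on (X 1) p1" and "closed_proper_convex_on (Y 1) q1"
    and "smooth_convex f Df" and "smooth_convex g Dg"
    and "\<forall>i\<in>{1..m}. linear (Ai i) \<and> range (Ai i) \<subseteq> X i"
    and "\<forall>j\<in>{1..n}. linear (Bj j) \<and> range (Bj j) \<subseteq> Y j"
    and "linear A" and "\<forall>u. adjoint A u = (\<Sum>i\<in>{1..m}. adjoint (Ai i) (blk X i u))"
    and "linear B" and "\<forall>v. adjoint B v = (\<Sum>j\<in>{1..n}. adjoint (Bj j) (blk Y j v))"
    and "psd \<Sigma>f" and "\<forall>u u'. f u \<le> majorant f Df \<Sigma>f u u'"
    and "psd \<Sigma>g" and "\<forall>v v'. g v \<le> majorant g Dg \<Sigma>g v v'"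
    and "\<forall>i\<in>{1..m}. psd_on (X i) (S i)" and "\<forall>j\<in>{1..n}. psd_on (Y j) (T j)"
    and "\<sigma> > 0" and "0 < \<tau>" and "\<tau> < (1 + sqrt 5) / 2"
    and "\<forall>k. 0 \<le> \<epsilon> k" and "summable \<epsilon>"
  defines "p \<equiv> \<lambda>u. p1 (blk X 1 u)" and "q \<equiv> \<lambda>v. q1 (blk Y 1 v)"
  assumes "p (x 0) < \<infinity>" and "q (y 0) < \<infinity>"
  defines "L \<equiv> \<lambda>k. aug_lagrangian p (\<lambda>u. majorant f Df \<Sigma>f u (x k))
                              q (\<lambda>v. majorant g Dg \<Sigma>g v (y k)) A B c \<sigma> (z k)"
    and "Mt \<equiv> M_tilde X m \<Sigma>f A \<sigma> S" and "Nt \<equiv> M_tilde Y n \<Sigma>g B \<sigma> T"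
    and "Sh \<equiv> S_hat X m \<Sigma>f A \<sigma> S" and "Th \<equiv> S_hat Y n \<Sigma>g B \<sigma> T"
    and "Mh \<equiv> M_hat X m \<Sigma>f A \<sigma> S" and "Nh \<equiv> M_hat Y n \<Sigma>g B \<sigma> T"
    and "x_sweep \<equiv> \<lambda>k.
        sweep X m (\<lambda>u. L k u (y k)) S (\<epsilon> k) (x k) (xt (k+1)) (x (k+1)) (\<delta>t k) (\<delta> k)"
    and "y_sweep \<equiv> \<lambda>k.
        sweep Y n (\<lambda>v. L k (x (k+1)) v) T (\<epsilon> k) (y k) (yt (k+1)) (y (k+1)) (\<gamma>t k) (\<gamma> k)"
    and "iteration \<equiv> \<lambda>k. x_sweep k \<and> y_sweep k \<and>
        z (k+1) = z k + (\<tau> * \<sigma>) *\<^sub>R (adjoint A (x (k+1)) + adjoint B (y (k+1)) - c)"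
    and "dx \<equiv> \<lambda>k. err_vec X m Mt (\<delta> k) (\<delta>t k)"
    and "dy \<equiv> \<lambda>k. err_vec Y n Nt (\<gamma> k) (\<gamma>t k)"
  assumes "pos_def (diag_part X m Mt)" and "pos_def (diag_part Y n Nt)"
  shows "(\<forall>k. (\<forall>l<k. iteration l) \<longrightarrow>
            sweep_executable X m (\<lambda>u. L k u (y k)) S (\<epsilon> k) (x k) \<and>
            (x_sweep k \<longrightarrow> sweep_executable Y n (\<lambda>v. L k (x (k+1)) v) T (\<epsilon> k) (y k)))
    \<and> Mh = (\<lambda>u. Mt u + sGS X m Mt u) \<and> pos_def Mh
    \<and> Nh = (\<lambda>v. Nt v + sGS Y n Nt v) \<and> pos_def Nh
    \<and> ((\<forall>k. iteration k) \<longrightarrow> (\<forall>k.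
          dx k \<in> subdiff UNIV (\<lambda>u. L k u (y k) + ereal (1/2 * sqn Sh (u - x k))) (x (k+1))
        \<and> dy k \<in> subdiff UNIV (\<lambda>v. L k (x (k+1)) v + ereal (1/2 * sqn Th (v - y k))) (y (k+1))
        \<and> norm (inv (psd_sqrt Mh) (dx k)) \<le> err_const X m Mt * \<epsilon> k
        \<and> norm (inv (psd_sqrt Nh) (dy k)) \<le> err_const Y n Nt * \<epsilon> k))"
proof -
  have p: "p u = p1 (blk X 1 u)" and q: "q v = q1 (blk Y 1 v)" for u v by (simp_all add: p_def q_def)
  have p_MInf: "p u \<noteq> -\<infinity>" for u
    unfolding p using \<open>closed_proper_convex_on (X 1) p1\<close> blk_in[OF \<open>orthogonal_blocks X m\<close>, of 1 u] \<open>m \<ge> 1\<close>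
    by (simp add: closed_proper_convex_on_def)
  have q_MInf: "q v \<noteq> -\<infinity>" for v
    unfolding q using \<open>closed_proper_convex_on (Y 1) q1\<close> blk_in[OF \<open>orthogonal_blocks Y n\<close>, of 1 v] \<open>n \<ge> 1\<close>
    by (simp add: closed_proper_convex_on_def)
  have Mt_pos: "pos_def (diag_part X m (M_tilde X m \<Sigma>f A \<sigma> S))"
    and Nt_pos: "pos_def (diag_part Y n (M_tilde Y n \<Sigma>g B \<sigma> T))"
    using \<open>pos_def (diag_part X m Mt)\<close> \<open>pos_def (diag_part Y n Nt)\<close> by (simp_all only: Mt_def Nt_def)
  have xhs: "half_step X m p1 \<Sigma>f A \<sigma> S q v" if "q v < \<infinity>" for v
  proof (rule half_step.intro)
    show "\<bar>q v\<bar> \<noteq> \<infinity>" using that q_MInf[of v] by auto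
  qed fact+
  have yhs: "half_step Y n q1 \<Sigma>g B \<sigma> T p u" if "p u < \<infinity>" for u
  proof (rule half_step.intro)
    show "\<bar>p u\<bar> \<noteq> \<infinity>" using that p_MInf[of u] by auto
  qed fact+
  have Ly: "(\<lambda>v. L k u v) = (\<lambda>v. aug_lagrangian q (\<lambda>v. majorant g Dg \<Sigma>g v (y k))
      p (\<lambda>u. majorant f Df \<Sigma>f u (x k)) B A c \<sigma> (z k) v u)" for k u
    unfolding L_def by (intro ext aug_lagrangian_commute)
  have Mh: "Mh = (\<lambda>u. Mt u + sGS X m Mt u)" and Nh: "Nh = (\<lambda>v. Nt v + sGS Y n Nt v)"
    unfolding Mh_def Mt_def Nh_def Nt_def by (rule M_hat_eq)+
  have \<epsilon>: "0 \<le> \<epsilon> k" for k using \<open>\<forall>k. 0 \<le> \<epsilon> k\<close> by blast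

  have x_exec: "sweep_executable X m (\<lambda>u. L k u (y k)) S (\<epsilon> k) (x k)"
    if "p (x k) < \<infinity>" "q (y k) < \<infinity>" for k
    unfolding L_def p_def
    by (rule half_step.L_executable[OF xhs[OF that(2)]]) (use that(1) \<epsilon> p in simp_all)
  have y_exec: "sweep_executable Y n (\<lambda>v. L k (x (k+1)) v) T (\<epsilon> k) (y k)"
    if "p (x (k+1)) < \<infinity>" "q (y k) < \<infinity>" for k
    unfolding Ly q_def
    by (rule half_step.L_executable[OF yhs[OF that(1)]]) (use that(2) \<epsilon> q in simp_all)
  have x_fin: "p (x (k+1)) < \<infinity>" if "q (y k) < \<infinity>" "x_sweep k" for k
    unfolding p by (rule half_step.L_finite[OF xhs[OF that(1)] that(2)[unfolded x_sweep_def L_def p_def]])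
  have y_fin: "q (y (k+1)) < \<infinity>" if "p (x (k+1)) < \<infinity>" "y_sweep k" for k
    unfolding q by (rule half_step.L_finite[OF yhs[OF that(1)] that(2)[unfolded y_sweep_def Ly q_def]])
  \<comment> \<open>The invariant behind every later step: iterates stay in the domains. A finite y
    value makes the x sweep yield a finite x value, which in turn serves the y sweep.\<close>
  have fin: "p (x k) < \<infinity> \<and> q (y k) < \<infinity>" if "\<forall>l<k. iteration l" for k
    using that
  proof (induction k)
    case 0
    show ?case using \<open>p (x 0) < \<infinity>\<close> \<open>q (y 0) < \<infinity>\<close> by blast
  next
    case (Suc k)
    have "q (y k) < \<infinity>" "x_sweep k" "y_sweep k"
      using Suc unfolding iteration_def by auto
    thus ?case using x_fin[of k] y_fin[of k] by simp
  qed

  have "sweep_executable X m (\<lambda>u. L k u (y k)) S (\<epsilon> k) (x k) \<and>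
      (x_sweep k \<longrightarrow> sweep_executable Y n (\<lambda>v. L k (x (k+1)) v) T (\<epsilon> k) (y k))"
    if "\<forall>l<k. iteration l" for k
    using fin[OF that] x_exec x_fin y_exec by blast
  moreover have "pos_def Mh"
    unfolding Mh_def by (rule pos_def_M_hat) fact+
  moreover have "pos_def Nh"
    unfolding Nh_def by (rule pos_def_M_hat) fact+
  moreover have "dx k \<in> subdiff UNIV (\<lambda>u. L k u (y k) + ereal (1/2 * sqn Sh (u - x k))) (x (k+1))
      \<and> dy k \<in> subdiff UNIV (\<lambda>v. L k (x (k+1)) v + ereal (1/2 * sqn Th (v - y k))) (y (k+1))
      \<and> norm (inv (psd_sqrt Mh) (dx k)) \<le> err_const X m Mt * \<epsilon> k
      \<and> norm (inv (psd_sqrt Nh) (dy k)) \<le> err_const Y n Nt * \<epsilon> k"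
    if it: "\<forall>k. iteration k" for k
  proof -
    \<comment> \<open>The y half step freezes the new x iterate, so the invariant is also used at k
      + 1.\<close>
    have xk: "p (x k) < \<infinity>" and yk: "q (y k) < \<infinity>" and xk1: "p (x (k+1)) < \<infinity>"
      using fin[of k] fin[of "k+1"] it by auto
    have xs: "x_sweep k" and ys: "y_sweep k" using it by (auto simp: iteration_def)
    note xs' = xs[unfolded x_sweep_def L_def p_def] and ys' = ys[unfolded y_sweep_def Ly q_def]
    note xhs' = xhs[OF yk] and yhs' = yhs[OF xk1]
    have "dx k \<in> subdiff UNIV (\<lambda>u. L k u (y k) + ereal (1/2 * sqn Sh (u - x k))) (x (k+1))"
      unfolding dx_def Mt_def Sh_def L_def p_def
      by (rule half_step.L_subdiff[OF xhs' xk[unfolded p] xs'])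
    moreover have "dy k \<in> subdiff UNIV (\<lambda>v. L k (x (k+1)) v + ereal (1/2 * sqn Th (v - y k))) (y (k+1))"
      unfolding dy_def Nt_def Th_def Ly q_def
      by (rule half_step.L_subdiff[OF yhs' yk[unfolded q] ys'])
    moreover have "norm (inv (psd_sqrt Mh) (dx k)) \<le> err_const X m Mt * \<epsilon> k"
      unfolding dx_def Mt_def Mh_def by (rule half_step.L_norm_bound[OF xhs' xs' \<epsilon>])
    moreover have "norm (inv (psd_sqrt Nh) (dy k)) \<le> err_const Y n Nt * \<epsilon> k"
      unfolding dy_def Nt_def Nh_def by (rule half_step.L_norm_bound[OF yhs' ys' \<epsilon>])
    ultimately show ?thesis by blast
  qed
  ultimately show ?thesis using Mh Nh by blast
qed

end
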